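(* Let $p\in(0,1)$, let $(e,S)$ be the signed Brownian excursion of parameter $p$, and let $\tilde e$ be a random CRT excursion defined on the same probability space such that (1) $\tilde e$ has the distribution of a normalized Brownian excursion, with the same field of local times at time $1$ as $e$, and (2) almost surely $d_{\tilde e}(\varphi_{e,S}(x),\varphi_{e,S}(y))=d_e(x,y)$ for all $x,y\in[0,1]$ and $\tilde e\circ\varphi_{e,S}=e$. Let $\jmath:\mathcal T_e\to\mathcal T_{\tilde e}$ be the unique map with $\jmath\circ\pi_e=\pi_{\tilde e}\circ\varphi_{e,S}$. Then, almost surely: (a) $\tilde e$ and $\jmath$ are uniquely determined by the fact that $\tilde e$ is continuous and $\jmath$ is an isomorphism (of pointed, ordered, measured metric spaces) between $(\mathcal T_e,d_e,\rho_e,\leq_e^S,\lambda_e)$ and $(\mathcal T_{\tilde e},d_{\tilde e},\rho_{\tilde e},\leq_{\tilde e},\lambda_{\tilde e})$; that is, if $h$ is a continuous excursion and $k$ is an isomorphism between $(\mathcal T_e,d_e,\rho_e,\leq_e^S,\lambda_e)$ and $(\mathcal T_h,d_h,\rho_h,\leq_h,\lambda_h)$, then $h=\tilde e$ and $k=\jmath$. (b) Any function $\phi:[0,1]\to[0,1]$ satisfying $\pi_{\tilde e}\circ\phi=\jmath\circ\pi_e$ must coincide with $\varphi_{e,S}$ on a set of measure $1$, hence still satisfies $\mu_{e,S}=(\mathrm{Id},\phi)_*\mathrm{Leb}$.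
   Context: **CRT excursions.** A continuous excursion is a continuous $g:[0,1]\to[0,\infty)$ with $g(0)=g(1)=0$ and $g>0$ on $(0,1)$. Its inner local minima are the points of $(0,1)$ at which $g$ is locally minimal. A point $x\in(0,1)$ is not a one-sided minimum of $g$ if for all $\epsilon>0$ there are $x_1\in(x-\epsilon,x)$ and $x_2\in(x,x+\epsilon)$ with $g(x_1)<g(x)$ and $g(x_2)<g(x)$. Such a $g$ is a CRT excursion if its inner local minima are dense in $[0,1]$, the values of $g$ at its inner local minima are all different, and the set of points that are not one-sided minima has Lebesgue measure $1$. Then all inner local minima are strict and countable. $\mathcal E$ denotes the set of CRT excursions. **Measurable enumeration.** Fix functions $b_i:\mathcal E\to[0,1]$, $i\in\mathbb N$, such that: for every $g$, $i\mapsto b_i(g)$ is a bijection from $\mathbb N$ onto the inner local minima of $g$; each $b_i$ is measurable; and the function mapping $(g,u,v)$ to $i$ if $b_i(g)\in(u,v)$ is the unique point of $[u,v]$ at which the minimum of $g$ on $[u,v]$ is reached, and to $\infty$ otherwise, is measurable. **Signed excursions and order.** A signed excursion is a pair $(g,s)$, $g\in\mathcal E$, $s\in\{\oplus,\ominus\}^{\mathbb N}$. For $x<y$ in $[0,1]$, $x,y$ are $g$-comparable if the minimum of $g$ on $[x,y]$ is reached at a unique point, which is a strict local minimum $b_i\in(x,y)$. In that case $x\lhd_g^s y$ if $s_i=\oplus$, and $y\lhd_g^s x$ if $s_i=\ominus$. Set $\varphi_{g,s}(t)=\mathrm{Leb}\{u\in[0,1]:u\lhd_g^s t\}$ and $\mu_{g,s}=(\mathrm{Id},\varphi_{g,s})_*\mathrm{Leb}$.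 **Signed Brownian excursion.** $e$ is a normalized Brownian excursion (almost surely a CRT excursion) and $S$ is an independent sequence of i.i.d. signs, each $\oplus$ with probability $p$ and $\ominus$ with probability $1-p$. **Trees.** For a continuous excursion $g$, $d_g(x,y)=g(x)+g(y)-2\min_{[x\wedge y,\,x\vee y]}g$ is a pseudo-distance on $[0,1]$; $(\mathcal T_g,d_g)$ is the quotient metric space obtained by identifying points at pseudo-distance $0$, with canonical surjection $\pi_g:[0,1]\to\mathcal T_g$; $\rho_g=\pi_g(0)$; $\lambda_g=(\pi_g)_*\mathrm{Leb}$; and $\leq_g$ is the total order on $\mathcal T_g$ given by $x\leq_g y\iff\inf\pi_g^{-1}(x)\leq\inf\pi_g^{-1}(y)$. For a signed excursion $(g,s)$, the total order $\leq_g^s$ on $\mathcal T_g$ is defined as follows: let $x\leq_g y$; if there is a strict local minimum $b_i$ with $\sup\pi_g^{-1}(x)<b_i<\inf\pi_g^{-1}(y)$, $g(b_i)=\inf\{g(t):\sup\pi_g^{-1}(x)\le t\le\inf\pi_g^{-1}(y)\}$ and $s_i=\ominus$, then $y\leq_g^s x$; otherwise $x\leq_g^s y$. **Isomorphism.** An isomorphism of pointed, ordered, measured metric spaces is a bijective isometry mapping root to root, increasing for the two orders, and pushing forward the first measure to the second. The map $\jmath$ is well defined because $d_e(x,y)=0$ implies $d_{\tilde e}(\varphi_{e,S}(x),\varphi_{e,S}(y))=0$. The field of local times at time $1$ of $g$ is the family of densities at levels $y\ge0$ of its occupation measure $A\mapsto\mathrm{Leb}\{t:g(t)\in A\}$.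 *)

theory Defs
  imports "HOL-Probability.Probability"
begin

section \<open>CRT excursions\<close>

text \<open>
  Functions on the unit interval are represented by functions on the reals. An excursion is
  extended by zero, so that equality of excursions on the unit interval is equality of functions.
\<close>

definition continuous_excursion :: "(real \<Rightarrow> real) \<Rightarrow> bool" where
  "continuous_excursion g \<longleftrightarrow>
     continuous_on {0..1} g \<and> g 0 = 0 \<and> g 1 = 0 \<and> (\<forall>x\<in>{0<..<1}. g x > 0) \<and>
     (\<forall>x. x \<notin> {0..1} \<longrightarrow> g x = 0)"

definition inner_local_minima :: "(real \<Rightarrow> real) \<Rightarrow> real set" where
  "inner_local_minima g = {x \<in> {0<..<1}. \<forall>\<^sub>F y in at x. g x \<le> g y}"

definition not_one_sided_minima :: "(real \<Rightarrow> real) \<Rightarrow> real set" where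
  "not_one_sided_minima g =
     {x \<in> {0<..<1}. \<forall>\<epsilon>>0. \<exists>x1\<in>{x-\<epsilon><..<x}. \<exists>x2\<in>{x<..<x+\<epsilon>}. g x1 < g x \<and> g x2 < g x}"

definition crt_excursions :: "(real \<Rightarrow> real) set" where
  "crt_excursions = {g. continuous_excursion g \<and>
     {0..1} \<subseteq> closure (inner_local_minima g) \<and>
     inj_on g (inner_local_minima g) \<and>
     emeasure lebesgue (not_one_sided_minima g) = 1}"

text \<open>
  The sigma-algebra generated by the evaluations; on continuous functions it is the Borel
  sigma-algebra of uniform convergence.
\<close>

abbreviation path_space :: "(real \<Rightarrow> real) measure" where
  "path_space \<equiv> (\<Pi>\<^sub>M t\<in>UNIV. borel)"

definition crt_space :: "(real \<Rightarrow> real) measure" where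
  "crt_space = restrict_space path_space crt_excursions"

section \<open>Measurable enumeration of the inner local minima\<close>

definition unique_min_at ::
    "(nat \<Rightarrow> (real \<Rightarrow> real) \<Rightarrow> real) \<Rightarrow> (real \<Rightarrow> real) \<Rightarrow> nat \<Rightarrow> real \<Rightarrow> real \<Rightarrow> bool" where
  "unique_min_at b g i u v \<longleftrightarrow>
     b i g \<in> {u<..<v} \<and> (\<forall>z\<in>{u..v}. z \<noteq> b i g \<longrightarrow> g (b i g) < g z)"

definition min_index ::
    "(nat \<Rightarrow> (real \<Rightarrow> real) \<Rightarrow> real) \<Rightarrow> (real \<Rightarrow> real) \<Rightarrow> real \<Rightarrow> real \<Rightarrow> enat" where
  "min_index b g u v =
     (if \<exists>i. unique_min_at b g i u v then enat (THE i. unique_min_at b g i u v) else \<infinity>)"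

definition measurable_enumeration :: "(nat \<Rightarrow> (real \<Rightarrow> real) \<Rightarrow> real) \<Rightarrow> bool" where
  "measurable_enumeration b \<longleftrightarrow>
     (\<forall>g\<in>crt_excursions. bij_betw (\<lambda>i. b i g) UNIV (inner_local_minima g)) \<and>
     (\<forall>i. b i \<in> borel_measurable crt_space) \<and>
     (\<lambda>(g, u, v). min_index b g u v) \<in>
       crt_space \<Otimes>\<^sub>M (restrict_space borel {0..1} \<Otimes>\<^sub>M restrict_space borel {0..1})
         \<rightarrow>\<^sub>M count_space UNIV"

section \<open>Signed excursions\<close>

datatype sign = Plus | Minus

text \<open>
  The strict relation between comparable points. A unique minimum attained at an interior point
  is automatically a strict local minimum.
\<close>

definition signed_less ::
    "(nat \<Rightarrow> (real \<Rightarrow> real) \<Rightarrow> real) \<Rightarrow> (real \<Rightarrow> real) \<Rightarrow> (nat \<Rightarrow> sign) \<Rightarrow> real \<Rightarrow> real \<Rightarrow> bool" where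
  "signed_less b g s x y \<longleftrightarrow>
     (x < y \<and> (\<exists>i. unique_min_at b g i x y \<and> s i = Plus)) \<or>
     (y < x \<and> (\<exists>i. unique_min_at b g i y x \<and> s i = Minus))"

definition varphi ::
    "(nat \<Rightarrow> (real \<Rightarrow> real) \<Rightarrow> real) \<Rightarrow> (real \<Rightarrow> real) \<Rightarrow> (nat \<Rightarrow> sign) \<Rightarrow> real \<Rightarrow> real" where
  "varphi b g s t = measure lebesgue {u \<in> {0..1}. signed_less b g s u t}"

definition permuton ::
    "(nat \<Rightarrow> (real \<Rightarrow> real) \<Rightarrow> real) \<Rightarrow> (real \<Rightarrow> real) \<Rightarrow> (nat \<Rightarrow> sign) \<Rightarrow> (real \<times> real) measure" where
  "permuton b g s = distr (lebesgue_on {0..1}) borel (\<lambda>t. (t, varphi b g s t))"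

section \<open>The signed Brownian excursion\<close>

text \<open>
  \<open>entrance_density t x\<close> is the density at time \<open>t\<close> of the hitting time of \<open>x\<close> by Brownian motion
  started at 0, and \<open>killed_density\<close> is the transition density of Brownian motion killed at 0.
  For times \<open>0 < t 0 < \<dots> < t (n-1) < 1\<close>, the normalized Brownian excursion has the
  finite-dimensional density \<open>excursion_density n t\<close>.
\<close>

definition entrance_density :: "real \<Rightarrow> real \<Rightarrow> real" where
  "entrance_density t x = x / sqrt (2 * pi * t ^ 3) * exp (- x\<^sup>2 / (2 * t))"

definition killed_density :: "real \<Rightarrow> real \<Rightarrow> real \<Rightarrow> real" where
  "killed_density t x y =
     (exp (- (x - y)\<^sup>2 / (2 * t)) - exp (- (x + y)\<^sup>2 / (2 * t))) / sqrt (2 * pi * t)"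

definition excursion_density :: "nat \<Rightarrow> (nat \<Rightarrow> real) \<Rightarrow> (nat \<Rightarrow> real) \<Rightarrow> real" where
  "excursion_density n t x =
     (if \<forall>i<n. x i > 0 then
        2 * sqrt (2 * pi) * entrance_density (t 0) (x 0) *
        (\<Prod>i<n-1. killed_density (t (Suc i) - t i) (x i) (x (Suc i))) *
        entrance_density (1 - t (n-1)) (x (n-1))
      else 0)"

definition brownian_excursion :: "'w measure \<Rightarrow> ('w \<Rightarrow> real \<Rightarrow> real) \<Rightarrow> bool" where
  "brownian_excursion M e \<longleftrightarrow>
     e \<in> M \<rightarrow>\<^sub>M path_space \<and>
     (AE \<omega> in M. continuous_excursion (e \<omega>)) \<and>
     (\<forall>n t. 0 < n \<longrightarrow> strict_mono_on {..<n} t \<longrightarrow> t ` {..<n} \<subseteq> {0<..<1} \<longrightarrow>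
        distributed M (\<Pi>\<^sub>M i\<in>{..<n}. lborel) (\<lambda>\<omega>. \<lambda>i\<in>{..<n}. e \<omega> (t i))
          (\<lambda>x. ennreal (excursion_density n t x)))"

text \<open>
  A signed excursion has its first component in \<^const>\<open>crt_excursions\<close>; this is known to hold
  almost surely for a normalized Brownian excursion. Independence of \<open>e\<close> and \<open>S\<close> is stated for
  the generated sigma-algebras because \<open>indep_var\<close> requires random variables of the same type.
\<close>

definition signed_brownian_excursion ::
    "'w measure \<Rightarrow> real \<Rightarrow> ('w \<Rightarrow> real \<Rightarrow> real) \<Rightarrow> ('w \<Rightarrow> nat \<Rightarrow> sign) \<Rightarrow> bool" where
  "signed_brownian_excursion M p e S \<longleftrightarrow>
     brownian_excursion M e \<and> (AE \<omega> in M. e \<omega> \<in> crt_excursions) \<and>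
     prob_space.indep_vars M (\<lambda>_. count_space UNIV) (\<lambda>i \<omega>. S \<omega> i) UNIV \<and>
     (\<forall>i. measure M {\<omega> \<in> space M. S \<omega> i = Plus} = p) \<and>
     prob_space.indep_set M
       {e -` A \<inter> space M | A. A \<in> sets path_space}
       {S -` B \<inter> space M | B. B \<in> sets (\<Pi>\<^sub>M i\<in>UNIV. count_space UNIV)}"

text \<open>Local times at time 1 are determined up to null sets of levels.\<close>

definition local_times :: "(real \<Rightarrow> real) \<Rightarrow> (real \<Rightarrow> ennreal) \<Rightarrow> bool" where
  "local_times g L \<longleftrightarrow> L \<in> borel_measurable borel \<and>
     (\<forall>A\<in>sets borel. emeasure lebesgue {t \<in> {0..1}. g t \<in> A} = (\<integral>\<^sup>+y\<in>A \<inter> {0..}. L y \<partial>lborel))"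

definition same_local_times :: "(real \<Rightarrow> real) \<Rightarrow> (real \<Rightarrow> real) \<Rightarrow> bool" where
  "same_local_times g h \<longleftrightarrow> (\<exists>L. local_times g L \<and> local_times h L)"

section \<open>Pointed, ordered, measured metric spaces\<close>

record 'a pom_space =
  pom_points :: "'a set"
  pom_dist :: "'a \<Rightarrow> 'a \<Rightarrow> real"
  pom_root :: 'a
  pom_le :: "'a \<Rightarrow> 'a \<Rightarrow> bool"
  pom_measure :: "'a measure"

definition pom_isomorphism :: "('a \<Rightarrow> 'b) \<Rightarrow> 'a pom_space \<Rightarrow> 'b pom_space \<Rightarrow> bool" where
  "pom_isomorphism k X Y \<longleftrightarrow>
     bij_betw k (pom_points X) (pom_points Y) \<and>
     (\<forall>x\<in>pom_points X. \<forall>y\<in>pom_points X. pom_dist Y (k x) (k y) = pom_dist X x y) \<and>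
     k (pom_root X) = pom_root Y \<and>
     (\<forall>x\<in>pom_points X. \<forall>y\<in>pom_points X. pom_le X x y \<longrightarrow> pom_le Y (k x) (k y)) \<and>
     k \<in> pom_measure X \<rightarrow>\<^sub>M pom_measure Y \<and>
     distr (pom_measure X) (pom_measure Y) k = pom_measure Y"

section \<open>Trees coded by excursions\<close>

definition pseudo_dist :: "(real \<Rightarrow> real) \<Rightarrow> real \<Rightarrow> real \<Rightarrow> real" where
  "pseudo_dist g x y = g x + g y - 2 * (INF z\<in>{min x y..max x y}. g z)"

definition tree_rel :: "(real \<Rightarrow> real) \<Rightarrow> (real \<times> real) set" where
  "tree_rel g = {(x, y). x \<in> {0..1} \<and> y \<in> {0..1} \<and> pseudo_dist g x y = 0}"

definition tree_points :: "(real \<Rightarrow> real) \<Rightarrow> real set set" where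
  "tree_points g = {0..1} // tree_rel g"

definition tree_proj :: "(real \<Rightarrow> real) \<Rightarrow> real \<Rightarrow> real set" where
  "tree_proj g t = tree_rel g `` {t}"

text \<open>Points of the tree are equivalence classes; for \<open>X = tree_proj g t\<close>, the class \<open>X\<close> is also
  the fibre of \<^const>\<open>tree_proj\<close> over \<open>X\<close>.\<close>

definition tree_dist :: "(real \<Rightarrow> real) \<Rightarrow> real set \<Rightarrow> real set \<Rightarrow> real" where
  "tree_dist g X Y = pseudo_dist g (SOME x. x \<in> X) (SOME y. y \<in> Y)"

definition tree_borel :: "(real \<Rightarrow> real) \<Rightarrow> real set measure" where
  "tree_borel g = sigma (tree_points g)
     {U. openin (Metric_space.mtopology (tree_points g) (tree_dist g)) U}"

definition tree_measure :: "(real \<Rightarrow> real) \<Rightarrow> real set measure" where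
  "tree_measure g = distr (lebesgue_on {0..1}) (tree_borel g) (tree_proj g)"

definition tree_le :: "(real \<Rightarrow> real) \<Rightarrow> real set \<Rightarrow> real set \<Rightarrow> bool" where
  "tree_le g X Y \<longleftrightarrow> Inf X \<le> Inf Y"

definition tree_swapped ::
    "(nat \<Rightarrow> (real \<Rightarrow> real) \<Rightarrow> real) \<Rightarrow> (real \<Rightarrow> real) \<Rightarrow> (nat \<Rightarrow> sign) \<Rightarrow>
     real set \<Rightarrow> real set \<Rightarrow> bool" where
  "tree_swapped b g s X Y \<longleftrightarrow>
     (\<exists>i. Sup X < b i g \<and> b i g < Inf Y \<and>
          g (b i g) = (INF t\<in>{Sup X..Inf Y}. g t) \<and> s i = Minus)"

definition signed_tree_le ::
    "(nat \<Rightarrow> (real \<Rightarrow> real) \<Rightarrow> real) \<Rightarrow> (real \<Rightarrow> real) \<Rightarrow> (nat \<Rightarrow> sign) \<Rightarrow>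
     real set \<Rightarrow> real set \<Rightarrow> bool" where
  "signed_tree_le b g s X Y \<longleftrightarrow>
     (tree_le g X Y \<and> \<not> tree_swapped b g s X Y) \<or> (tree_le g Y X \<and> tree_swapped b g s Y X)"

definition tree_space :: "(real \<Rightarrow> real) \<Rightarrow> real set pom_space" where
  "tree_space g = \<lparr> pom_points = tree_points g, pom_dist = tree_dist g,
     pom_root = tree_proj g 0, pom_le = tree_le g, pom_measure = tree_measure g \<rparr>"

definition signed_tree_space ::
    "(nat \<Rightarrow> (real \<Rightarrow> real) \<Rightarrow> real) \<Rightarrow> (real \<Rightarrow> real) \<Rightarrow> (nat \<Rightarrow> sign) \<Rightarrow> real set pom_space" where
  "signed_tree_space b g s = (tree_space g)\<lparr> pom_le := signed_tree_le b g s \<rparr>"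

text \<open>Extensionality makes the induced map between the trees unique as a HOL function.\<close>

definition jmap ::
    "(nat \<Rightarrow> (real \<Rightarrow> real) \<Rightarrow> real) \<Rightarrow> (real \<Rightarrow> real) \<Rightarrow> (nat \<Rightarrow> sign) \<Rightarrow> (real \<Rightarrow> real) \<Rightarrow>
     real set \<Rightarrow> real set" where
  "jmap b g s h = (THE j. j \<in> tree_points g \<rightarrow>\<^sub>E tree_points h \<and>
     (\<forall>t\<in>{0..1}. j (tree_proj g t) = tree_proj h (varphi b g s t)))"

end

theory Submission
  imports Defs
begin

text \<open>
  The argument is deterministic: only the almost sure properties of \<open>e\<close> and \<open>e'\<close> matter. Let \<open>g\<close> and \<open>h\<close>
  be CRT excursions (the values of \<open>e\<close> and \<open>e'\<close>) and fix the signs, with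
  \<open>d\<^sub>h (\<phi> x) (\<phi> y) = d\<^sub>g x y\<close> and \<open>h \<circ> \<phi> = g\<close>. The relation \<open>signed_less\<close> is a measurable total order on the full set of points that are not one-sided minima, so its rank
  function \<open>\<phi>\<close> pushes Lebesgue measure to itself. Hence \<open>\<phi>\<close> has dense range, the isometry \<open>jmap\<close> is
  onto by compactness, and it preserves the measures. It preserves the orders because two points
  that are not ancestrally related are separated by a minimum, which also separates nearby points
  that are not one-sided minima, where \<open>\<phi>\<close> is monotone.

  Uniqueness: almost every point of the tree is a leaf, a metric property that an isomorphism
  transfers to the target \<open>\<T>\<^sub>h\<close>. There the leftmost time of a class \<open>X\<close> is the mass of the classes
  below \<open>X\<close>, and the height of \<open>X\<close> is its distance to the root, so both are read off the source.
\<close>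

section \<open>The tree coded by an excursion\<close>

text \<open>Two obstacles shape the proof. The map \<open>\<phi>\<close> is not known to be
  continuous, and it is known to be monotone only on \<open>not_one_sided_minima g\<close>.
  Continuity survives one level up: the equation between the pseudo-distances makes the class of
  \<open>\<phi> t\<close> in the tree of \<open>h\<close> move continuously with \<open>t\<close>,
  and the topological steps go through that class. Order statements are proved at times of the full
  set, which is dense, and reach arbitrary classes by approximation.

  That \<open>\<phi>\<close> preserves Lebesgue measure holds for the rank in any measurable total
  order without atoms: level sets of the rank are null by Fubini, rank values are fixed points of
  the distribution function of the rank, and null level sets close the gaps between fixed points.

  For uniqueness the competitor is merely a continuous excursion and might identify many times.
  Leaves are therefore handled through \<open>ancestor_times\<close>, whose nullness is a statement
  about metric, root and measure alone.\<close>

lemma excursion_nonneg: "continuous_excursion g \<Longrightarrow> 0 \<le> g x"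
  unfolding continuous_excursion_def
  by (metis atLeastAtMost_iff greaterThanLessThan_iff less_eq_real_def order.refl)

text \<open>The extension by zero glues continuously at 0 and 1, so perturbation arguments need no
  special care at the endpoints.\<close>

lemma excursion_continuous:
  assumes "continuous_excursion g"
  shows "continuous_on UNIV g"
proof -
  have "continuous_on ({0..1} \<union> ({..0} \<union> {1..})) g"
  proof (rule continuous_on_closed_Un)
    have "0 = g x" if "x \<in> {..0} \<union> {1..}" for x
      using assms that unfolding continuous_excursion_def by (cases "x = 0 \<or> x = 1") auto
    then show "continuous_on ({..0} \<union> {1..}) g"
      by (rule continuous_on_eq[OF continuous_on_const])
  qed (use assms in \<open>auto simp: continuous_excursion_def\<close>)
  moreover have "{0..1} \<union> ({..0} \<union> {1..}) = (UNIV :: real set)" by auto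
  ultimately show ?thesis by simp
qed

lemma excursion_Min:
  assumes "continuous_excursion g"
  obtains m where "m \<in> {min x y..max x y}" "g m = (INF z\<in>{min x y..max x y}. g z)"
    "\<And>z. z \<in> {min x y..max x y} \<Longrightarrow> g m \<le> g z"
proof -
  have "\<exists>m\<in>{min x y..max x y}. \<forall>z\<in>{min x y..max x y}. g m \<le> g z"
    using excursion_continuous[OF assms]
    by (intro continuous_attains_inf) (auto intro: continuous_on_subset)
  then obtain m where m: "m \<in> {min x y..max x y}" "\<And>z. z \<in> {min x y..max x y} \<Longrightarrow> g m \<le> g z"
    by blast
  then have "(INF z\<in>{min x y..max x y}. g z) = g m"
    by (intro cInf_eq_minimum) auto
  with m that show thesis by metis
qed

section \<open>The pseudo-distance coded by an excursion\<close>

lemma pseudo_dist_commute: "pseudo_dist g x y = pseudo_dist g y x"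
  unfolding pseudo_dist_def by (simp add: min.commute max.commute)

lemma pseudo_dist_self [simp]: "pseudo_dist g x x = 0"
  unfolding pseudo_dist_def by simp

lemma pseudo_dist_obtain:
  assumes "continuous_excursion g"
  obtains m where "m \<in> {min x y..max x y}" "pseudo_dist g x y = g x + g y - 2 * g m"
    "\<And>z. z \<in> {min x y..max x y} \<Longrightarrow> g m \<le> g z"
  using excursion_Min[OF assms, of x y] unfolding pseudo_dist_def by metis

lemma pseudo_dist_nonneg:
  assumes "continuous_excursion g"
  shows "0 \<le> pseudo_dist g x y"
proof -
  obtain m where m: "m \<in> {min x y..max x y}" "pseudo_dist g x y = g x + g y - 2 * g m"
    "\<And>z. z \<in> {min x y..max x y} \<Longrightarrow> g m \<le> g z"
    using pseudo_dist_obtain[OF assms] by metis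
  show ?thesis using m(2) m(3)[of x] m(3)[of y] by auto
qed

lemma pseudo_dist_zero_iff:
  assumes "continuous_excursion g"
  shows "pseudo_dist g x y = 0 \<longleftrightarrow> g x = g y \<and> (\<forall>z\<in>{min x y..max x y}. g x \<le> g z)"
proof -
  obtain m where m: "m \<in> {min x y..max x y}" "pseudo_dist g x y = g x + g y - 2 * g m"
    "\<And>z. z \<in> {min x y..max x y} \<Longrightarrow> g m \<le> g z"
    using pseudo_dist_obtain[OF assms] by metis
  show ?thesis using m(1,2) m(3)[of x] m(3)[of y] m(3)
    by (smt (verit) atLeastAtMost_iff)
qed

text \<open>The interval spanned by \<open>x\<close> and \<open>z\<close> is covered by the other
  two, so its minimum is at least one of theirs; the remaining minimum is bounded by
  \<open>g y\<close>.\<close>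

lemma pseudo_dist_triangle:
  assumes "continuous_excursion g"
  shows "pseudo_dist g x z \<le> pseudo_dist g x y + pseudo_dist g y z"
proof -
  obtain m where m: "m \<in> {min x y..max x y}" "pseudo_dist g x y = g x + g y - 2 * g m"
    "\<And>w. w \<in> {min x y..max x y} \<Longrightarrow> g m \<le> g w"
    using pseudo_dist_obtain[OF assms] by metis
  obtain n where n: "n \<in> {min y z..max y z}" "pseudo_dist g y z = g y + g z - 2 * g n"
    "\<And>w. w \<in> {min y z..max y z} \<Longrightarrow> g n \<le> g w"
    using pseudo_dist_obtain[OF assms] by metis
  obtain l where l: "l \<in> {min x z..max x z}" "pseudo_dist g x z = g x + g z - 2 * g l"
    using pseudo_dist_obtain[OF assms] by metis
  have "l \<in> {min x y..max x y} \<or> l \<in> {min y z..max y z}"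
    using l(1) by (auto simp: min_def max_def split: if_splits)
  then have "g m \<le> g l \<or> g n \<le> g l" using m n by blast
  moreover have "g m \<le> g y" "g n \<le> g y" using m(3)[of y] n(3)[of y] by auto
  ultimately show ?thesis using m(2) n(2) l(2) by auto
qed

lemma pseudo_dist_0:
  assumes "continuous_excursion g"
  shows "pseudo_dist g 0 x = g x"
proof -
  obtain m where m: "m \<in> {min 0 x..max 0 x}" "pseudo_dist g 0 x = g 0 + g x - 2 * g m"
    "\<And>z. z \<in> {min 0 x..max 0 x} \<Longrightarrow> g m \<le> g z"
    using pseudo_dist_obtain[OF assms] by metis
  have "g 0 = 0" using assms unfolding continuous_excursion_def by auto
  then show ?thesis using m(2) m(3)[of 0] excursion_nonneg[OF assms, of m] by auto
qed

lemma pseudo_dist_small: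
  assumes "continuous_excursion g" "0 < r"
  obtains d where "0 < d" "\<And>y. \<bar>y - x\<bar> < d \<Longrightarrow> pseudo_dist g x y < r"
proof -
  have "isCont g x" using excursion_continuous[OF assms(1)] continuous_on_eq_continuous_at by blast
  then obtain d where d: "0 < d" "\<And>y. \<bar>y - x\<bar> < d \<Longrightarrow> \<bar>g y - g x\<bar> < r / 4"
    using assms(2) unfolding continuous_at_eps_delta dist_real_def by (metis zero_less_divide_iff zero_less_numeral)
  have "pseudo_dist g x y < r" if y: "\<bar>y - x\<bar> < d" for y
  proof -
    obtain m where m: "m \<in> {min x y..max x y}" "pseudo_dist g x y = g x + g y - 2 * g m"
      using pseudo_dist_obtain[OF assms(1)] by metis
    then have "\<bar>m - x\<bar> < d" using y by auto
    then show ?thesis using d(2)[OF y] d(2)[of m] m(2) assms(2) by linarith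
  qed
  with d(1) that show thesis by blast
qed

lemma pseudo_dist_continuous:
  assumes "continuous_excursion g"
  shows "continuous_on UNIV (\<lambda>t. pseudo_dist g t z)"
  unfolding continuous_on_iff dist_real_def
proof clarsimp
  fix x r :: real assume "0 < r"
  then obtain d where d: "0 < d" "\<And>y. \<bar>y - x\<bar> < d \<Longrightarrow> pseudo_dist g x y < r"
    using pseudo_dist_small[OF assms] by metis
  have "\<bar>pseudo_dist g y z - pseudo_dist g x z\<bar> < r" if "\<bar>y - x\<bar> < d" for y
    using d(2)[OF that] pseudo_dist_triangle[OF assms, of y z x]
      pseudo_dist_triangle[OF assms, of x z y] pseudo_dist_commute[of g x y] by linarith
  then show "\<exists>d>0. \<forall>x'. \<bar>x' - x\<bar> < d \<longrightarrow> \<bar>pseudo_dist g x' z - pseudo_dist g x z\<bar> < r"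
    using d(1) by blast
qed

lemma pseudo_dist_zero_cong:
  assumes "continuous_excursion g" "pseudo_dist g x x' = 0" "pseudo_dist g y y' = 0"
  shows "pseudo_dist g x y = pseudo_dist g x' y'"
  using assms(2,3) pseudo_dist_triangle[OF assms(1), of x y x'] pseudo_dist_triangle[OF assms(1), of x' y y']
    pseudo_dist_triangle[OF assms(1), of x' y' x] pseudo_dist_triangle[OF assms(1), of x y' y]
    pseudo_dist_commute[of g x x'] pseudo_dist_commute[of g y y'] by linarith

section \<open>The quotient by pseudo-distance 0 as a metric space\<close>

lemma tree_rel_equiv:
  assumes "continuous_excursion g"
  shows "equiv {0..1} (tree_rel g)"
proof (rule equivI)
  show "trans (tree_rel g)"
    unfolding trans_def tree_rel_def
    using pseudo_dist_triangle[OF assms] pseudo_dist_nonneg[OF assms]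
    by (auto intro: order.antisym) (smt (verit))
qed (auto simp: refl_on_def sym_def tree_rel_def pseudo_dist_commute)

lemma mem_tree_proj_iff:
  "y \<in> tree_proj g x \<longleftrightarrow> x \<in> {0..1} \<and> y \<in> {0..1} \<and> pseudo_dist g x y = 0"
  unfolding tree_proj_def tree_rel_def by auto

lemma tree_proj_in [intro, simp]: "x \<in> {0..1} \<Longrightarrow> tree_proj g x \<in> tree_points g"
  unfolding tree_proj_def tree_points_def by (rule quotientI)

lemma tree_proj_eq_iff:
  assumes "continuous_excursion g" "x \<in> {0..1}" "y \<in> {0..1}"
  shows "tree_proj g x = tree_proj g y \<longleftrightarrow> pseudo_dist g x y = 0"
  unfolding tree_proj_def eq_equiv_class_iff[OF tree_rel_equiv[OF assms(1)] assms(2,3)]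
  using assms(2,3) by (auto simp: tree_rel_def)

lemma tree_point_eq_proj:
  assumes "continuous_excursion g" "X \<in> tree_points g" "x \<in> X"
  shows "x \<in> {0..1}" "X = tree_proj g x"
proof -
  obtain t where t: "t \<in> {0..1}" "X = tree_proj g t"
    using assms(2) unfolding tree_points_def tree_proj_def by (blast elim: quotientE)
  then show "x \<in> {0..1}" using assms(3) mem_tree_proj_iff by blast
  then show "X = tree_proj g x"
    using t assms(3) tree_proj_eq_iff[OF assms(1)] mem_tree_proj_iff by blast
qed

lemma tree_points_eq: "tree_points g = tree_proj g ` {0..1}"
  unfolding tree_points_def tree_proj_def quotient_def by auto

lemma tree_point_compact:
  assumes "continuous_excursion g" "X \<in> tree_points g"
  shows "compact X" "X \<noteq> {}"
proof -
  obtain t where t: "t \<in> {0..1}" "X = tree_proj g t"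
    using assms(2) tree_points_eq by blast
  have "X = {0..1} \<inter> {y. pseudo_dist g y t = 0}"
    using t mem_tree_proj_iff by (auto simp: pseudo_dist_commute)
  moreover have "closed {y. pseudo_dist g y t = 0}"
    using pseudo_dist_continuous[OF assms(1)] by (intro closed_Collect_eq) auto
  ultimately show "compact X" by (auto intro: compact_Int_closed)
  show "X \<noteq> {}" using t mem_tree_proj_iff[of t g t] by auto
qed

text \<open>Compactness puts the first and the last visit into the class itself, so they serve as
  canonical representatives.\<close>

lemma tree_point_Inf_Sup:
  assumes "continuous_excursion g" "X \<in> tree_points g"
  shows "Inf X \<in> X" "Sup X \<in> X" "\<And>x. x \<in> X \<Longrightarrow> Inf X \<le> x" "\<And>x. x \<in> X \<Longrightarrow> x \<le> Sup X"
  using tree_point_compact[OF assms]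
  by (auto intro!: closed_contains_Inf closed_contains_Sup cInf_lower cSup_upper compact_imp_closed
      bounded_imp_bdd_below bounded_imp_bdd_above compact_imp_bounded)

lemma tree_point_eqI:
  assumes "continuous_excursion g" "X \<in> tree_points g" "Y \<in> tree_points g" "x \<in> X" "x \<in> Y"
  shows "X = Y"
  using tree_point_eq_proj[OF assms(1,2,4)] tree_point_eq_proj[OF assms(1,3,5)] by simp

lemma tree_dist_eq:
  assumes "continuous_excursion g" "X \<in> tree_points g" "Y \<in> tree_points g" "x \<in> X" "y \<in> Y"
  shows "tree_dist g X Y = pseudo_dist g x y"
proof -
  have *: "pseudo_dist g (SOME x. x \<in> X) x = 0" if "X \<in> tree_points g" "x \<in> X" for x X
  proof -
    have "(SOME x. x \<in> X) \<in> X" using that by (auto intro: someI)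
    then show ?thesis
      using tree_point_eq_proj[OF assms(1)] that mem_tree_proj_iff by (metis (no_types, lifting))
  qed
  show ?thesis unfolding tree_dist_def
    by (rule pseudo_dist_zero_cong[OF assms(1) *[OF assms(2,4)] *[OF assms(3,5)]])
qed

lemma tree_dist_proj:
  assumes "continuous_excursion g" "x \<in> {0..1}" "y \<in> {0..1}"
  shows "tree_dist g (tree_proj g x) (tree_proj g y) = pseudo_dist g x y"
  by (rule tree_dist_eq[OF assms(1)]) (use assms in \<open>auto simp: mem_tree_proj_iff\<close>)

lemma tree_metric:
  assumes "continuous_excursion g"
  shows "Metric_space (tree_points g) (tree_dist g)"
proof
  fix X Y :: "real set"
  show "0 \<le> tree_dist g X Y" unfolding tree_dist_def by (rule pseudo_dist_nonneg[OF assms])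
  show "tree_dist g X Y = tree_dist g Y X" unfolding tree_dist_def by (rule pseudo_dist_commute)
  { fix Z show "tree_dist g X Z \<le> tree_dist g X Y + tree_dist g Y Z"
      unfolding tree_dist_def by (rule pseudo_dist_triangle[OF assms]) }
  assume "X \<in> tree_points g" "Y \<in> tree_points g"
  then obtain x y where "x \<in> {0..1}" "y \<in> {0..1}" "X = tree_proj g x" "Y = tree_proj g y"
    unfolding tree_points_eq by blast
  then show "tree_dist g X Y = 0 \<longleftrightarrow> X = Y"
    using tree_dist_proj[OF assms] tree_proj_eq_iff[OF assms] by simp
qed

section \<open>Topology, Borel sets and mass measure of the tree\<close>

lemma tree_proj_continuous:
  assumes "continuous_excursion g"
  shows "continuous_map (top_of_set {0..1}) (Metric_space.mtopology (tree_points g) (tree_dist g)) (tree_proj g)"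
proof -
  interpret Metric_space "tree_points g" "tree_dist g" by (rule tree_metric[OF assms])
  interpret I: Metric_space "{0..1::real}" dist
    by unfold_locales (auto simp: dist_commute dist_triangle)
  have *: "top_of_set {0..1} = I.mtopology"
  proof -
    interpret Submetric UNIV dist "{0..1::real}" by unfold_locales auto
    show ?thesis using mtopology_submetric mtopology_is_euclidean by metis
  qed
  have "continuous_map I.mtopology mtopology (tree_proj g)"
    unfolding I.metric_continuous_map[OF tree_metric[OF assms]]
  proof (intro conjI ballI allI impI)
    fix x r :: real assume x: "x \<in> {0..1}" and "0 < r"
    then obtain d where d: "0 < d" "\<And>y. \<bar>y - x\<bar> < d \<Longrightarrow> pseudo_dist g x y < r"
      using pseudo_dist_small[OF assms] by metis
    show "\<exists>\<delta>>0. \<forall>y. y \<in> {0..1} \<and> dist x y < \<delta> \<longrightarrow> tree_dist g (tree_proj g x) (tree_proj g y) < r"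
      using d x by (intro exI[of _ d]) (auto simp: tree_dist_proj[OF assms] dist_real_def)
  qed auto
  then show ?thesis by (simp add: *)
qed

lemma space_tree_borel [simp]: "space (tree_borel g) = tree_points g"
  unfolding tree_borel_def by (rule space_measure_of_conv)

lemma tree_borel_open:
  assumes "continuous_excursion g"
    "openin (Metric_space.mtopology (tree_points g) (tree_dist g)) U"
  shows "U \<in> sets (tree_borel g)"
proof -
  interpret Metric_space "tree_points g" "tree_dist g" by (rule tree_metric[OF assms(1)])
  have "{U. openin mtopology U} \<subseteq> Pow (tree_points g)"
    using openin_subset by fastforce
  then show ?thesis unfolding tree_borel_def using assms(2) by (auto intro: sigma_sets.Basic)
qed

lemma tree_borel_closed:
  assumes "continuous_excursion g"
    "closedin (Metric_space.mtopology (tree_points g) (tree_dist g)) U"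
  shows "U \<in> sets (tree_borel g)"
proof -
  interpret Metric_space "tree_points g" "tree_dist g" by (rule tree_metric[OF assms(1)])
  have "tree_points g - U \<in> sets (tree_borel g)"
    using tree_borel_open[OF assms(1)] assms(2) by (simp add: closedin_def)
  from sets.compl_sets[OF this] show ?thesis
    using closedin_subset[OF assms(2)] by (simp add: double_diff)
qed

lemma tree_borel_measurable_into:
  assumes "continuous_excursion g" "f \<in> space M \<rightarrow> tree_points g"
    "\<And>U. openin (Metric_space.mtopology (tree_points g) (tree_dist g)) U \<Longrightarrow> f -` U \<inter> space M \<in> sets M"
  shows "f \<in> M \<rightarrow>\<^sub>M tree_borel g"
proof -
  interpret Metric_space "tree_points g" "tree_dist g" by (rule tree_metric[OF assms(1)])
  have "{U. openin mtopology U} \<subseteq> Pow (tree_points g)"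
    using openin_subset by fastforce
  then show ?thesis unfolding tree_borel_def
    using assms(2,3) by (intro measurable_measure_of) auto
qed

lemma tree_proj_measurable:
  assumes "continuous_excursion g"
  shows "tree_proj g \<in> restrict_space borel {0..1} \<rightarrow>\<^sub>M tree_borel g"
proof (rule tree_borel_measurable_into[OF assms])
  fix U assume "openin (Metric_space.mtopology (tree_points g) (tree_dist g)) U"
  then have "openin (top_of_set {0..1}) {x \<in> {0..1}. tree_proj g x \<in> U}"
    using openin_continuous_map_preimage[OF tree_proj_continuous[OF assms]] by fastforce
  then obtain V where "open V" "{x \<in> {0..1}. tree_proj g x \<in> U} = {0..1} \<inter> V"
    unfolding openin_open by blast
  moreover have "tree_proj g -` U \<inter> {0..1} = {x \<in> {0..1}. tree_proj g x \<in> U}" by auto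
  ultimately show "tree_proj g -` U \<inter> space (restrict_space borel {0..1}) \<in> sets (restrict_space borel {0..1})"
    by (auto simp: space_restrict_space sets_restrict_space)
qed (auto simp: space_restrict_space)

text \<open>A compact set of times has a compact, hence closed, image in the Hausdorff tree. This
  makes the images of initial intervals and of sets of ancestor times measurable.\<close>

lemma tree_image_compact_borel:
  assumes "continuous_excursion g" "compact C" "C \<subseteq> {0..1}"
  shows "tree_proj g ` C \<in> sets (tree_borel g)"
proof (rule tree_borel_closed[OF assms(1)])
  interpret Metric_space "tree_points g" "tree_dist g" by (rule tree_metric[OF assms(1)])
  have "compactin (top_of_set {0..1}) C" using assms by (simp add: compactin_subtopology)
  then have "compactin mtopology (tree_proj g ` C)"
    using image_compactin tree_proj_continuous[OF assms(1)] by blast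
  then show "closedin mtopology (tree_proj g ` C)"
    using compactin_imp_closedin Hausdorff_space_mtopology by blast
qed

lemma lebesgue_on_measurable_from_borel:
  assumes "f \<in> restrict_space borel S \<rightarrow>\<^sub>M N" "S \<in> sets borel"
  shows "f \<in> lebesgue_on S \<rightarrow>\<^sub>M N"
  using assms
  by (auto simp: measurable_def space_restrict_space sets_restrict_space_iff)

lemma space_tree_measure [simp]: "space (tree_measure g) = tree_points g"
  and sets_tree_measure [simp]: "sets (tree_measure g) = sets (tree_borel g)"
  unfolding tree_measure_def by auto

lemma emeasure_tree_measure:
  assumes "continuous_excursion g" "A \<in> sets (tree_borel g)"
  shows "emeasure (tree_measure g) A = emeasure (lebesgue_on {0..1}) {t \<in> {0..1}. tree_proj g t \<in> A}"
proof -
  have "tree_proj g -` A \<inter> space (lebesgue_on {0..1}) = {t \<in> {0..1}. tree_proj g t \<in> A}"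
    by (auto simp: space_restrict_space)
  then show ?thesis unfolding tree_measure_def
    using assms by (simp add: emeasure_distr lebesgue_on_measurable_from_borel[OF tree_proj_measurable])
qed

section \<open>The rank function of a random total order\<close>

lemma prob_space_unit_interval: "prob_space (lebesgue_on {0..1::real})"
  by (rule prob_spaceI) (simp add: space_restrict_space emeasure_restrict_space)

text \<open>The excursion is abstracted away. What remains is joint measurability, for Fubini, and
  the order axioms on a set \<open>N\<close> of full probability, because two arbitrary times need
  not be comparable.\<close>

locale random_order = prob_space M for M :: "'a measure" +
  fixes r :: "'a \<Rightarrow> 'a \<Rightarrow> bool" and N :: "'a set"
  assumes r_sets: "{(u, t) \<in> space M \<times> space M. r u t} \<in> sets (M \<Otimes>\<^sub>M M)"
    and N_sets: "N \<in> events" and N_prob: "prob N = 1"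
    and atomless: "t \<in> N \<Longrightarrow> {t} \<in> events \<and> prob {t} = 0"
    and total: "u \<in> N \<Longrightarrow> t \<in> N \<Longrightarrow> u \<noteq> t \<Longrightarrow> r u t \<or> r t u"
    and asym: "u \<in> N \<Longrightarrow> t \<in> N \<Longrightarrow> r u t \<Longrightarrow> \<not> r t u"
    and trans: "u \<in> N \<Longrightarrow> t \<in> N \<Longrightarrow> v \<in> N \<Longrightarrow> r u t \<Longrightarrow> r t v \<Longrightarrow> r u v"
begin

definition rank :: "'a \<Rightarrow> real" where
  "rank t = prob {u \<in> space M. r u t}"

lemma N_subset: "N \<subseteq> space M"
  using N_sets by (rule sets.sets_into_space)

lemma section_vimage:
  "t \<in> space M \<Longrightarrow> {u \<in> space M. r u t} = (\<lambda>u. (u, t)) -` {(u, t) \<in> space M \<times> space M. r u t}"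
  "t \<in> space M \<Longrightarrow> {u \<in> space M. r t u} = Pair t -` {(u, t) \<in> space M \<times> space M. r u t}"
  by auto

lemma section_sets:
  assumes "t \<in> space M"
  shows "{u \<in> space M. r u t} \<in> events" "{u \<in> space M. r t u} \<in> events"
  using section_vimage[OF assms] sets_Pair2[OF r_sets, of t] sets_Pair1[OF r_sets, of t] by simp_all

lemma rank_measurable [measurable]: "rank \<in> borel_measurable M"
proof -
  interpret MP: pair_prob_space M M by unfold_locales
  have *: "(\<lambda>t. enn2real (emeasure M ((\<lambda>u. (u, t)) -` {(u, t) \<in> space M \<times> space M. r u t}))) \<in> borel_measurable M"
    using MP.measurable_emeasure_Pair2[OF r_sets] by simp
  have "rank \<in> borel_measurable M \<longleftrightarrow>
      (\<lambda>t. enn2real (emeasure M ((\<lambda>u. (u, t)) -` {(u, t) \<in> space M \<times> space M. r u t}))) \<in> borel_measurable M"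
    by (rule measurable_cong) (simp only: rank_def section_vimage(1) measure_def)
  with * show ?thesis by (rule iffD2[rotated])
qed

lemma AE_N: "AE t in M. t \<in> N"
  using N_prob N_sets by (simp add: prob_eq_1)

lemma prob_Int_N: "A \<in> events \<Longrightarrow> prob (A \<inter> N) = prob A"
  by (rule finite_measure_eq_AE) (use AE_N N_sets in auto)

text \<open>Fubini on \<open>L \<times> L\<close>, whose two halves \<open>r u t\<close> and \<open>r t u\<close> have the same measure.\<close>

lemma constant_section_half:
  assumes L: "L \<in> events" "L \<subseteq> N" and c: "\<And>t. t \<in> L \<Longrightarrow> prob {u \<in> L. r u t} = c"
  shows "c * prob L = (prob L - c) * prob L"
proof -
  interpret MP: pair_prob_space M M by unfold_locales
  define A where "A = {(u, t) \<in> space M \<times> space M. r u t} \<inter> (L \<times> L)"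
  have A: "A \<in> sets (M \<Otimes>\<^sub>M M)" unfolding A_def using r_sets L by auto
  have L_space: "L \<subseteq> space M" using L N_subset by auto
  \<comment> \<open>By totality and asymmetry \<open>L\<close> splits into the two sections at
    \<open>t\<close> and the null point \<open>t\<close> itself.\<close>
  have c': "prob {u \<in> L. r t u} = prob L - c" if t: "t \<in> L" for t
  proof -
    have ev: "{u \<in> L. r u t} \<in> events" "{u \<in> L. r t u} \<in> events"
    proof -
      have "{u \<in> L. r u t} = L \<inter> {u \<in> space M. r u t}" "{u \<in> L. r t u} = L \<inter> {u \<in> space M. r t u}"
        using L_space by auto
      then show "{u \<in> L. r u t} \<in> events" "{u \<in> L. r t u} \<in> events"
        using section_sets[of t] t L L_space by auto
    qed
    have tt: "{t} \<in> events" "prob {t} = 0" using atomless t L by auto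
    have "L = ({u \<in> L. r u t} \<union> {u \<in> L. r t u}) \<union> {t}"
      using total[of _ t] t L by auto
    then have "prob L = prob (({u \<in> L. r u t} \<union> {u \<in> L. r t u}) \<union> {t})" by simp
    also have "\<dots> = prob ({u \<in> L. r u t} \<union> {u \<in> L. r t u})"
      using ev tt by (intro measure_Un_null_set) (auto simp: null_sets_def emeasure_eq_measure)
    also have "\<dots> = prob {u \<in> L. r u t} + prob {u \<in> L. r t u}"
      using ev asym[of _ t] t L by (intro finite_measure_Union) auto
    finally show ?thesis using c[OF t] by simp
  qed
  have c_bounds: "0 \<le> c" "0 \<le> prob L - c" if "L \<noteq> {}"
  proof -
    from that obtain t where "t \<in> L" by blast
    from c[OF this] c'[OF this] show "0 \<le> c" "0 \<le> prob L - c"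
      using measure_nonneg[of M "{u \<in> L. r u t}"] measure_nonneg[of M "{u \<in> L. r t u}"] by linarith+
  qed
  have "ennreal (c * prob L) = emeasure (M \<Otimes>\<^sub>M M) A" if "L \<noteq> {}"
  proof -
    have "0 \<le> c" by (rule c_bounds(1)[OF that])
    have "emeasure (M \<Otimes>\<^sub>M M) A = (\<integral>\<^sup>+t. emeasure M ((\<lambda>u. (u, t)) -` A) \<partial>M)"
      by (rule MP.emeasure_pair_measure_alt2[OF A])
    also have "\<dots> = (\<integral>\<^sup>+t. ennreal c * indicator L t \<partial>M)"
    proof (intro nn_integral_cong)
      fix t
      have "(\<lambda>u. (u, t)) -` A = (if t \<in> L then {u \<in> L. r u t} else {})"
        unfolding A_def using L_space by auto
      then show "emeasure M ((\<lambda>u. (u, t)) -` A) = ennreal c * indicator L t"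
        by (cases "t \<in> L") (simp_all add: emeasure_eq_measure c)
    qed
    also have "\<dots> = ennreal (c * prob L)"
      using L \<open>0 \<le> c\<close> by (simp add: nn_integral_cmult_indicator emeasure_eq_measure ennreal_mult)
    finally show ?thesis by simp
  qed
  moreover have "ennreal ((prob L - c) * prob L) = emeasure (M \<Otimes>\<^sub>M M) A" if "L \<noteq> {}"
  proof -
    have "0 \<le> prob L - c" by (rule c_bounds(2)[OF that])
    have "emeasure (M \<Otimes>\<^sub>M M) A = (\<integral>\<^sup>+t. emeasure M (Pair t -` A) \<partial>M)"
      by (rule emeasure_pair_measure_alt[OF A])
    also have "\<dots> = (\<integral>\<^sup>+t. ennreal (prob L - c) * indicator L t \<partial>M)"
    proof (intro nn_integral_cong)
      fix t
      have "Pair t -` A = (if t \<in> L then {u \<in> L. r t u} else {})"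
        unfolding A_def using L_space by auto
      then show "emeasure M (Pair t -` A) = ennreal (prob L - c) * indicator L t"
        by (cases "t \<in> L") (simp_all add: emeasure_eq_measure c')
    qed
    also have "\<dots> = ennreal ((prob L - c) * prob L)"
      using L \<open>0 \<le> prob L - c\<close> by (simp add: nn_integral_cmult_indicator emeasure_eq_measure ennreal_mult)
    finally show ?thesis by simp
  qed
  ultimately have *: "ennreal (c * prob L) = ennreal ((prob L - c) * prob L)" if "L \<noteq> {}"
    using that by simp
  show ?thesis
  proof (cases "L = {}")
    case False
    have nn: "0 \<le> c * prob L" "0 \<le> (prob L - c) * prob L"
      using c_bounds[OF False] by simp_all
    from *[OF False] show ?thesis unfolding ennreal_inj[OF nn] .
  qed simp
qed

text \<open>Transitivity is available only inside \<open>N\<close>, so the section below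
  \<open>t\<close> is first cut down to \<open>N\<close>, at no cost in probability.\<close>

lemma rank_mono:
  assumes "t \<in> N" "v \<in> N" "r t v"
  shows "rank t \<le> rank v"
proof -
  have "rank t = prob ({u \<in> space M. r u t} \<inter> N)"
    unfolding rank_def using assms N_subset by (intro prob_Int_N[symmetric] section_sets) auto
  also have "\<dots> \<le> rank v"
    unfolding rank_def using assms N_subset trans[OF _ assms(1,2) _ assms(3)]
    by (intro finite_measure_mono section_sets) auto
  finally show ?thesis .
qed

text \<open>On a level set \<open>L\<close> all sections \<open>{u \<in> L. r u t}\<close> have the same measure \<open>c\<close>, hence \<open>2 * c = prob L\<close>.
  The same argument inside one such section, whose sections again have measure \<open>c\<close>, gives \<open>c = 0\<close>.\<close>

lemma rank_level_null: "prob {t \<in> N. rank t = m} = 0"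
proof (rule ccontr)
  define L where "L = {t \<in> N. rank t = m}"
  assume "prob {t \<in> N. rank t = m} \<noteq> 0"
  then have pos: "0 < prob L" unfolding L_def by (simp add: zero_less_measure_iff)
  have L_eq: "L = N \<inter> (rank -` {m} \<inter> space M)" using N_subset unfolding L_def by auto
  have L: "L \<in> events" "L \<subseteq> N"
    unfolding L_eq using N_sets by auto
  have below: "{u \<in> L. r u t} \<in> events" if "t \<in> L" for t
  proof -
    have "{u \<in> L. r u t} = L \<inter> {u \<in> space M. r u t}" using L N_subset by auto
    then show ?thesis using section_sets(1)[of t] that L N_subset by auto
  qed
  \<comment> \<open>Along \<open>r u t\<close> the sections are nested, and equal ranks mean that
    their difference is null; this persists after intersecting with \<open>L\<close>.\<close>
  have step: "prob {x \<in> L. r x u} = prob {x \<in> L. r x t}" if "u \<in> L" "t \<in> L" "r u t" for u t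
  proof -
    have ev: "{x \<in> space M. r x u} \<inter> N \<in> events" "{x \<in> space M. r x t} \<inter> N \<in> events"
      using that L N_subset N_sets by (auto intro!: sets.Int section_sets)
    have sub: "{x \<in> space M. r x u} \<inter> N \<subseteq> {x \<in> space M. r x t} \<inter> N"
      using trans[OF _ _ _ _ \<open>r u t\<close>] that L by blast
    have "prob ({x \<in> space M. r x t} \<inter> N - {x \<in> space M. r x u} \<inter> N) = rank t - rank u"
      using finite_measure_Diff[OF ev(2,1) sub] that L N_subset
      by (simp add: rank_def prob_Int_N section_sets subset_iff)
    also have "\<dots> = 0" using that unfolding L_def by auto
    finally have D: "prob ({x \<in> space M. r x t} \<inter> N - {x \<in> space M. r x u} \<inter> N) = 0" .
    have "{x \<in> L. r x t} - {x \<in> L. r x u} \<subseteq> {x \<in> space M. r x t} \<inter> N - {x \<in> space M. r x u} \<inter> N"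
      using L N_subset by auto
    then have "prob ({x \<in> L. r x t} - {x \<in> L. r x u}) \<le> 0"
      unfolding D[symmetric] using ev by (intro finite_measure_mono) auto
    moreover have "prob ({x \<in> L. r x t} - {x \<in> L. r x u}) = prob {x \<in> L. r x t} - prob {x \<in> L. r x u}"
    proof (intro finite_measure_Diff below that)
      show "{x \<in> L. r x u} \<subseteq> {x \<in> L. r x t}"
        using trans[OF _ _ _ _ \<open>r u t\<close>] that L by blast
    qed
    moreover have "0 \<le> prob ({x \<in> L. r x t} - {x \<in> L. r x u})" by simp
    ultimately show ?thesis by linarith
  qed
  have "L \<noteq> {}" using pos by auto
  then obtain t0 where t0: "t0 \<in> L" by blast
  define c where "c = prob {u \<in> L. r u t0}"
  have const: "prob {u \<in> L. r u t} = c" if t: "t \<in> L" for t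
  proof -
    consider "t = t0" | "r t t0" | "r t0 t" using total[of t t0] t t0 L by blast
    then show ?thesis
    proof cases
      case 1 then show ?thesis unfolding c_def by simp
    next
      case 2 from step[OF t t0 this] show ?thesis unfolding c_def .
    next
      case 3 from step[OF t0 t this, symmetric] show ?thesis unfolding c_def .
    qed
  qed
  have half: "2 * c = prob L"
    using constant_section_half[OF L const] pos by (simp add: algebra_simps)
  define L' where "L' = {u \<in> L. r u t0}"
  have L': "L' \<in> events" "L' \<subseteq> N" using below[OF t0] L unfolding L'_def by auto
  have "prob {u \<in> L'. r u t} = c" if "t \<in> L'" for t
  proof -
    have "t \<in> L" "r t t0" using that unfolding L'_def by auto
    then have "r u t0" if "u \<in> L" "r u t" for u
      using trans[of u t t0] that t0 L by blast
    then have "{u \<in> L'. r u t} = {u \<in> L. r u t}"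
      unfolding L'_def by blast
    then show ?thesis using const[of t] that unfolding L'_def by simp
  qed
  \<comment> \<open>Here the total mass is itself \<open>c\<close>, so the identity reads
    \<open>c * c = (c - c) * c\<close>.\<close>
  from constant_section_half[OF L' this] have "c * c = 0"
    unfolding L'_def c_def by simp
  then show False using half pos by simp
qed

lemma rank_level_null': "prob {t \<in> space M. rank t = m} = 0"
proof -
  have "{t \<in> space M. rank t = m} \<inter> N = {t \<in> N. rank t = m}" using N_subset by auto
  then show ?thesis using prob_Int_N[of "{t \<in> space M. rank t = m}"] rank_level_null[of m] by simp
qed

lemma measure_distr_rank:
  "A \<in> sets borel \<Longrightarrow> measure (distr M borel rank) A = prob {t \<in> space M. rank t \<in> A}"
  by (subst measure_distr) (auto intro!: arg_cong[where f = prob])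

text \<open>Up to null sets, the section below \<open>t\<close> is squeezed between the strict and
  the weak sublevel set of \<open>rank\<close> at \<open>rank t\<close>, and these differ only by a
  null level set.\<close>

lemma cdf_rank:
  assumes "t \<in> N"
  shows "cdf (distr M borel rank) (rank t) = rank t"
proof -
  have eq: "cdf (distr M borel rank) (rank t) = prob {u \<in> space M. rank u \<le> rank t}"
    by (simp add: cdf_def measure_distr_rank)
  have "rank t = prob ({u \<in> space M. r u t} \<inter> N)"
    using assms N_subset unfolding rank_def by (intro prob_Int_N[symmetric] section_sets) auto
  also have "\<dots> \<le> prob {u \<in> space M. rank u \<le> rank t}"
    using rank_mono assms by (intro finite_measure_mono) auto
  finally have 1: "rank t \<le> prob {u \<in> space M. rank u \<le> rank t}" .
  have "prob {u \<in> space M. rank u \<le> rank t}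
      \<le> prob ({u \<in> space M. rank u < rank t} \<union> {u \<in> space M. rank u = rank t})"
    by (intro finite_measure_mono) auto
  also have "\<dots> \<le> prob {u \<in> space M. rank u < rank t} + prob {u \<in> space M. rank u = rank t}"
    by (intro measure_Un_le) auto
  also have "\<dots> = prob ({u \<in> space M. rank u < rank t} \<inter> N)"
    using rank_level_null'[of "rank t"] prob_Int_N[of "{u \<in> space M. rank u < rank t}"] by simp
  also have "\<dots> \<le> rank t"
  proof -
    have "{u \<in> space M. rank u < rank t} \<inter> N \<subseteq> {u \<in> space M. r u t}"
    proof
      fix u assume u: "u \<in> {u \<in> space M. rank u < rank t} \<inter> N"
      then have "\<not> r t u" "u \<noteq> t" using rank_mono[OF assms, of u] by auto
      then show "u \<in> {u \<in> space M. r u t}" using total[OF _ assms, of u] u by blast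
    qed
    then show ?thesis unfolding rank_def[of t]
      using assms N_subset by (intro finite_measure_mono section_sets) auto
  qed
  finally show ?thesis using 1 eq by simp
qed

text \<open>The fixed points of the distribution function are closed and carry the law of \<open>rank\<close>, so a gap
  between two of them has no mass, that is, no length.\<close>

lemma cdf_rank_eq:
  assumes "a \<in> {0..1}"
  shows "cdf (distr M borel rank) a = a"
proof -
  interpret D: real_distribution "distr M borel rank" by simp
  let ?G = "cdf (distr M borel rank)"
  define R where "R = {x. ?G x = x}"
  have atom: "measure (distr M borel rank) {x} = 0" for x
    using rank_level_null'[of x] by (simp add: measure_distr_rank)
  have cont: "continuous_on UNIV ?G"
    using D.isCont_cdf atom by (simp add: continuous_at_imp_continuous_on)
  have R_closed: "closed R"
    unfolding R_def using cont by (intro closed_Collect_eq) auto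
  have rank01: "0 \<le> rank t" "rank t \<le> 1" for t unfolding rank_def by auto
  have "?G 0 = prob {t \<in> space M. rank t = 0}"
  proof -
    have "rank t \<le> 0 \<longleftrightarrow> rank t = 0" for t using rank01(1)[of t] by linarith
    then show ?thesis by (simp add: cdf_def measure_distr_rank)
  qed
  then have R0: "0 \<in> R" unfolding R_def by (simp add: rank_level_null')
  have R1: "1 \<in> R"
    unfolding R_def using rank01 by (simp add: cdf_def measure_distr_rank prob_space)
  \<comment> \<open>These are the ends of the gap of \<open>R\<close> around \<open>a\<close>; they
    coincide exactly when \<open>a\<close> is a fixed point.\<close>
  define c d where "c = Sup (R \<inter> {..a})" and "d = Inf (R \<inter> {a..})"
  have c: "c \<in> R \<inter> {..a}"
    unfolding c_def using R0 assms R_closed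
    by (intro closed_contains_Sup) (auto intro: bdd_aboveI[of _ a])
  have d: "d \<in> R \<inter> {a..}"
    unfolding d_def using R1 assms R_closed
    by (intro closed_contains_Inf) (auto intro: bdd_belowI[of _ a])
  have gap: "x \<le> c \<or> d \<le> x" if "x \<in> R" for x
  proof (cases "x \<le> a")
    case True
    then show ?thesis using that unfolding c_def
      by (intro disjI1 cSup_upper) (auto intro: bdd_aboveI[of _ a])
  next
    case False
    then show ?thesis using that unfolding d_def
      by (intro disjI2 cInf_lower) (auto intro: bdd_belowI[of _ a])
  qed
  have "d = c"
  proof (rule ccontr)
    assume "d \<noteq> c"
    then have "c < d" using c d by auto
    then have "?G d - ?G c = measure (distr M borel rank) {c<..d}"
      by (simp add: D.cdf_diff_eq)
    also have "\<dots> = prob {t \<in> space M. c < rank t \<and> rank t \<le> d}"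
      by (simp add: measure_distr_rank)
    also have "\<dots> = prob ({t \<in> space M. c < rank t \<and> rank t \<le> d} \<inter> N)"
      by (intro prob_Int_N[symmetric]) measurable
    also have "\<dots> \<le> prob {t \<in> space M. rank t = d}"
    proof (intro finite_measure_mono subsetI)
      \<comment> \<open>The rank of a point of \<open>N\<close> is a fixed point, so a value in the
        half-open gap can only be its right end \<open>d\<close>.\<close>
      fix t assume t: "t \<in> {t \<in> space M. c < rank t \<and> rank t \<le> d} \<inter> N"
      then have "rank t \<in> R" unfolding R_def using cdf_rank by simp
      then show "t \<in> {t \<in> space M. rank t = d}" using gap t by force
    qed auto
    also have "\<dots> = 0" by (rule rank_level_null')
    finally show False using \<open>c < d\<close> c d unfolding R_def by simp
  qed
  then have "a \<in> R" using c d by auto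
  then show ?thesis unfolding R_def by simp
qed

lemma distr_rank: "distr M borel rank = distr (lebesgue_on {0..1}) borel (\<lambda>x. x)"
proof (rule cdf_unique)
  interpret U: prob_space "lebesgue_on {0..1::real}" by (rule prob_space_unit_interval)
  have id: "(\<lambda>x. x) \<in> borel_measurable (lebesgue_on {0..1::real})"
    by (intro measurable_restrict_space1 measurable_completion) simp
  show "real_distribution (distr M borel rank)" by simp
  show "real_distribution (distr (lebesgue_on {0..1}) borel (\<lambda>x::real. x))"
    using U.real_distribution_distr[OF id] .
  have rank01: "0 \<le> rank t" "rank t \<le> 1" for t unfolding rank_def by auto
  show "cdf (distr M borel rank) = cdf (distr (lebesgue_on {0..1}) borel (\<lambda>x. x))"
  proof
    fix a :: real
    have U: "cdf (distr (lebesgue_on {0..1}) borel (\<lambda>x. x)) a = measure lebesgue ({0..1} \<inter> {..a})"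
      unfolding cdf_def using id
      by (subst measure_distr) (auto simp: measure_restrict_space space_restrict_space Int_commute)
    consider "a < 0" | "a \<in> {0..1}" | "1 < a" by fastforce
    then show "cdf (distr M borel rank) a = cdf (distr (lebesgue_on {0..1}) borel (\<lambda>x. x)) a"
    proof cases
      case 1
      then have "\<not> rank t \<le> a" for t using rank01(1)[of t] by linarith
      moreover from 1 have "{0..1} \<inter> {..a} = {}" by auto
      ultimately show ?thesis unfolding U by (simp add: cdf_def measure_distr_rank)
    next
      case 2
      then have "{0..1} \<inter> {..a} = {0..a}" by auto
      then show ?thesis unfolding U cdf_rank_eq[OF 2] using 2 by simp
    next
      case 3
      then have "rank t \<le> a" for t using rank01(2)[of t] by linarith
      moreover from 3 have "{0..1} \<inter> {..a} = {0..1}" by auto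
      ultimately show ?thesis unfolding U by (simp add: cdf_def measure_distr_rank prob_space)
    qed
  qed
qed

end

section \<open>CRT excursions\<close>

text \<open>These are the times whose tree point lies on the segment from the root to the point of
  \<open>z\<close>. The metric form, rather than one by minima, is what a root preserving isometry
  transports.\<close>

definition ancestor_times :: "(real \<Rightarrow> real) \<Rightarrow> real \<Rightarrow> real set" where
  "ancestor_times g z = {t \<in> {0..1}. pseudo_dist g 0 t + pseudo_dist g t z = pseudo_dist g 0 z}"

lemma ancestor_times_subset: "ancestor_times g z \<subseteq> {0..1}"
  unfolding ancestor_times_def by auto

lemma ancestor_times_compact:
  assumes "continuous_excursion g"
  shows "compact (ancestor_times g z)"
proof -
  have "closed {t. pseudo_dist g t 0 + pseudo_dist g t z = pseudo_dist g 0 z}"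
    by (intro closed_Collect_eq continuous_on_add pseudo_dist_continuous[OF assms] continuous_on_const)
  then have "compact ({0..1} \<inter> {t. pseudo_dist g t 0 + pseudo_dist g t z = pseudo_dist g 0 z})"
    by (intro compact_Int_closed) auto
  moreover have "ancestor_times g z = {0..1} \<inter> {t. pseudo_dist g t 0 + pseudo_dist g t z = pseudo_dist g 0 z}"
    unfolding ancestor_times_def by (auto simp: pseudo_dist_commute[of g 0])
  ultimately show ?thesis by simp
qed

text \<open>Distances to the root are heights, so the segment equation collapses to saying that the
  minimum between the two times is attained at \<open>t\<close>.\<close>

lemma mem_ancestor_times_iff:
  assumes "continuous_excursion g"
  shows "t \<in> ancestor_times g z \<longleftrightarrow> t \<in> {0..1} \<and> (\<forall>w\<in>{min t z..max t z}. g t \<le> g w)"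
proof -
  obtain m where m: "m \<in> {min t z..max t z}" "pseudo_dist g t z = g t + g z - 2 * g m"
    "\<And>w. w \<in> {min t z..max t z} \<Longrightarrow> g m \<le> g w"
    using pseudo_dist_obtain[OF assms] by metis
  have "pseudo_dist g 0 t + pseudo_dist g t z = pseudo_dist g 0 z \<longleftrightarrow> g t = g m"
    unfolding pseudo_dist_0[OF assms] m(2) by auto
  also have "\<dots> \<longleftrightarrow> (\<forall>w\<in>{min t z..max t z}. g t \<le> g w)"
    using m(1,3) m(3)[of t] by (auto intro: order.antisym)
  finally show ?thesis unfolding ancestor_times_def by simp
qed

text \<open>Between two identified times the path explores the part of the tree above their common
  point, and a rational time occurs there. Countably many reference times thus catch every class
  with more than one element.\<close>

lemma non_singleton_ancestor:
  assumes "continuous_excursion g" "t \<in> {0..1}" "v \<in> {0..1}" "pseudo_dist g t v = 0" "t \<noteq> v"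
  shows "\<exists>q\<in>\<rat> \<inter> {0..1}. t \<in> ancestor_times g q"
proof -
  obtain q where q: "q \<in> \<rat>" "min t v < q" "q < max t v"
    using Rats_dense_in_real[of "min t v" "max t v"] assms(5) by (metis max_def min_def linorder_neqE_linordered_idom not_less_iff_gr_or_eq order.strict_iff_not)
  then have "{min t q..max t q} \<subseteq> {min t v..max t v}" and "q \<in> {0..1}"
    using assms(2,3) by (auto simp: min_def max_def split: if_splits)
  then have "t \<in> ancestor_times g q"
    using assms(2,4) unfolding mem_ancestor_times_iff[OF assms(1)] pseudo_dist_zero_iff[OF assms(1)] by blast
  with q \<open>q \<in> {0..1}\<close> show ?thesis by auto
qed

text \<open>Nullness is a hypothesis here because the lemma also serves for an excursion that is
  merely continuous, where nullness is transported by an isomorphism.\<close>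

lemma singleton_classes:
  assumes "continuous_excursion g" "\<And>z. z \<in> {0..1} \<Longrightarrow> ancestor_times g z \<in> null_sets lborel"
  obtains B where "B \<in> null_sets lborel" "\<And>t. t \<in> {0..1} - B \<Longrightarrow> tree_proj g t = {t}"
proof
  show "(\<Union>q\<in>\<rat> \<inter> {0..1}. ancestor_times g q) \<in> null_sets lborel"
    using assms(2) countable_rat by (intro null_sets_UN') auto
  fix t :: real assume t: "t \<in> {0..1} - (\<Union>q\<in>\<rat> \<inter> {0..1}. ancestor_times g q)"
  then have "v = t" if "v \<in> tree_proj g t" for v
    using non_singleton_ancestor[OF assms(1), of t v] that mem_tree_proj_iff[of v g t] by blast
  moreover have "t \<in> tree_proj g t" using t by (auto simp: mem_tree_proj_iff)
  ultimately show "tree_proj g t = {t}" by blast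
qed

lemma crt_continuous_excursion: "g \<in> crt_excursions \<Longrightarrow> continuous_excursion g"
  unfolding crt_excursions_def by simp

lemma not_one_sided_minima_lebesgue:
  assumes "g \<in> crt_excursions"
  shows "not_one_sided_minima g \<in> sets lebesgue" "not_one_sided_minima g \<subseteq> {0..1}"
    "{0..1} - not_one_sided_minima g \<in> null_sets lebesgue"
proof -
  have 1: "emeasure lebesgue (not_one_sided_minima g) = 1"
    using assms unfolding crt_excursions_def by simp
  then show s: "not_one_sided_minima g \<in> sets lebesgue"
    by (metis emeasure_notin_sets zero_neq_one)
  show sub: "not_one_sided_minima g \<subseteq> {0..1}" unfolding not_one_sided_minima_def by auto
  have "emeasure lebesgue ({0..1} - not_one_sided_minima g) = emeasure lebesgue {0..1::real} - 1"
    using emeasure_Diff[of lebesgue "not_one_sided_minima g" "{0..1}"] s sub 1 by simp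
  then show "{0..1} - not_one_sided_minima g \<in> null_sets lebesgue"
    using s by (auto simp: null_sets_def)
qed

lemma not_one_sided_minimaE:
  assumes "t \<in> not_one_sided_minima g" "u \<noteq> t"
  obtains w where "w \<in> {min u t<..<max u t}" "g w < g t"
proof -
  have *: "\<forall>\<epsilon>>0. \<exists>x1\<in>{t-\<epsilon><..<t}. \<exists>x2\<in>{t<..<t+\<epsilon>}. g x1 < g t \<and> g x2 < g t"
    using assms(1) unfolding not_one_sided_minima_def by simp
  obtain x1 x2 where x: "x1 \<in> {t - \<bar>u - t\<bar><..<t}" "x2 \<in> {t<..<t + \<bar>u - t\<bar>}" "g x1 < g t" "g x2 < g t"
    using *[rule_format, of "\<bar>u - t\<bar>"] assms(2) by auto
  show thesis
  proof (cases "u < t")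
    case True then show ?thesis using x that[of x1] by auto
  next
    case False then show ?thesis using x that[of x2] by auto
  qed
qed

text \<open>Between an ancestor time \<open>t\<close> and \<open>z\<close> the path does not go
  below \<open>g t\<close>, so \<open>t\<close> is a one-sided minimum unless it equals
  \<open>z\<close>.\<close>

lemma crt_ancestor_times_null:
  assumes "g \<in> crt_excursions"
  shows "ancestor_times g z \<in> null_sets lborel"
proof -
  note ce = crt_continuous_excursion[OF assms]
  have "ancestor_times g z \<subseteq> ({0..1} - not_one_sided_minima g) \<union> {z}"
  proof
    fix t assume t: "t \<in> ancestor_times g z"
    have False if N: "t \<in> not_one_sided_minima g" "z \<noteq> t"
    proof -
      obtain w where "w \<in> {min z t<..<max z t}" "g w < g t"
        using not_one_sided_minimaE[OF N] .
      then show False using t unfolding mem_ancestor_times_iff[OF ce]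
        by (metis atLeastAtMost_iff greaterThanLessThan_iff less_eq_real_def not_less min.commute max.commute)
    qed
    then show "t \<in> ({0..1} - not_one_sided_minima g) \<union> {z}"
      using t ancestor_times_subset by blast
  qed
  moreover have "({0..1} - not_one_sided_minima g) \<union> {z} \<in> null_sets lebesgue"
    using not_one_sided_minima_lebesgue(3)[OF assms] by (intro null_sets.Un) auto
  moreover have B: "ancestor_times g z \<in> sets borel"
    using ancestor_times_compact[OF ce] by (rule borel_compact)
  ultimately have "ancestor_times g z \<in> null_sets lebesgue"
    by (intro null_sets_subset[of _ lebesgue "ancestor_times g z"]) auto
  then show ?thesis using B by (auto simp: null_sets_def)
qed

lemma interior_min_inner_local_minima:
  assumes "m \<in> {u<..<t}" "m \<in> {0<..<1}" "\<And>z. z \<in> {u..t} \<Longrightarrow> g m \<le> g z"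
  shows "m \<in> inner_local_minima g"
proof -
  have "eventually (\<lambda>y. y \<in> {u<..<t}) (at m)"
    using assms(1) by (intro eventually_at_in_open') auto
  then have "\<forall>\<^sub>F y in at m. g m \<le> g y"
    by eventually_elim (use assms(3) in auto)
  then show ?thesis using assms(2) unfolding inner_local_minima_def by simp
qed

text \<open>Strict dips below both end values force the minimum into the interior, where it is an
  inner local minimum; uniqueness follows because \<open>g\<close> takes different values at
  these.\<close>

lemma unique_min_at_exists:
  assumes "g \<in> crt_excursions" "bij_betw (\<lambda>i. b i g) UNIV (inner_local_minima g)"
    and "u \<in> {0..1}" "t \<in> {0..1}" "u < t" "w \<in> {u..t}" "g w < g u" "w' \<in> {u..t}" "g w' < g t"
  obtains i where "unique_min_at b g i u t"
proof -
  obtain m where m: "m \<in> {min u t..max u t}" "\<And>z. z \<in> {min u t..max u t} \<Longrightarrow> g m \<le> g z"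
    using excursion_Min[OF crt_continuous_excursion[OF assms(1)]] by metis
  then have m: "m \<in> {u..t}" "\<And>z. z \<in> {u..t} \<Longrightarrow> g m \<le> g z" using assms(5) by auto
  have int: "z \<in> inner_local_minima g" if "z \<in> {u..t}" "g z = g m" for z
  proof (rule interior_min_inner_local_minima)
    have "z \<noteq> u" "z \<noteq> t" using that m(2)[OF assms(6)] m(2)[OF assms(8)] assms(7,9) by auto
    then show "z \<in> {u<..<t}" "z \<in> {0<..<1}" using that assms(3-5) by auto
    show "g z \<le> g y" if "y \<in> {u..t}" for y using m(2)[OF that] \<open>g z = g m\<close> by simp
  qed
  obtain i where i: "b i g = m" using int[OF m(1) refl] assms(2) unfolding bij_betw_def by (metis imageE)
  have "unique_min_at b g i u t"
    unfolding unique_min_at_def i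
  proof (intro conjI ballI impI)
    have "m \<noteq> u" "m \<noteq> t" using m(2)[OF assms(6)] m(2)[OF assms(8)] assms(7,9) by auto
    then show "m \<in> {u<..<t}" using m by auto
    fix z assume z: "z \<in> {u..t}" "z \<noteq> m"
    have "inj_on g (inner_local_minima g)" using assms(1) unfolding crt_excursions_def by simp
    then have "g z \<noteq> g m" using int z m(1) unfolding inj_on_def by metis
    then show "g m < g z" using m(2)[OF z(1)] by simp
  qed
  then show thesis using that by blast
qed

section \<open>The signed order on comparable times\<close>

lemma unique_min_at_index:
  assumes "inj (\<lambda>i. b i g)" "unique_min_at b g i u t" "unique_min_at b g j u t"
  shows "i = j"
proof -
  have "b i g = b j g"
    using assms(2,3) unfolding unique_min_at_def by (metis greaterThanLessThan_subseteq_atLeastAtMost_iff order.refl order.asym subsetD)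
  then show ?thesis using assms(1) by (auto dest: injD)
qed

text \<open>The lower of the two minima wins on the joined interval, and a tie is excluded by
  injectivity. Its index, hence its sign, is one of the two given.\<close>

lemma unique_min_at_join:
  assumes "inj_on g (range (\<lambda>i. b i g))"
    and "unique_min_at b g i x y" "unique_min_at b g j y z"
  shows "unique_min_at b g i x z \<or> unique_min_at b g j x z"
proof -
  have i: "b i g \<in> {x<..<y}" "\<And>w. w \<in> {x..y} \<Longrightarrow> w \<noteq> b i g \<Longrightarrow> g (b i g) < g w"
    and j: "b j g \<in> {y<..<z}" "\<And>w. w \<in> {y..z} \<Longrightarrow> w \<noteq> b j g \<Longrightarrow> g (b j g) < g w"
    using assms(2,3) unfolding unique_min_at_def by auto
  have "b i g \<noteq> b j g" using i(1) j(1) by auto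
  then have "g (b i g) \<noteq> g (b j g)" using assms(1) unfolding inj_on_def by blast
  then consider "g (b i g) < g (b j g)" | "g (b j g) < g (b i g)" by linarith
  then show ?thesis
  proof cases
    case 1
    have "g (b i g) < g w" if "w \<in> {x..z}" "w \<noteq> b i g" for w
      using i(2)[of w] j(2)[of w] that 1 by (cases "w \<le> y"; cases "w = b j g") auto
    then show ?thesis using i(1) j(1) unfolding unique_min_at_def by auto
  next
    case 2
    have "g (b j g) < g w" if "w \<in> {x..z}" "w \<noteq> b j g" for w
      using i(2)[of w] j(2)[of w] that 2 by (cases "w \<le> y"; cases "w = b i g") auto
    then show ?thesis using i(1) j(1) unfolding unique_min_at_def by auto
  qed
qed

lemma signed_less_forward_iff: "u < t \<Longrightarrow> signed_less b g s u t \<longleftrightarrow> (\<exists>i. unique_min_at b g i u t \<and> s i = Plus)"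
  and signed_less_backward_iff: "u < t \<Longrightarrow> signed_less b g s t u \<longleftrightarrow> (\<exists>i. unique_min_at b g i u t \<and> s i = Minus)"
  unfolding signed_less_def by auto

lemma signed_less_irrefl: "\<not> signed_less b g s u u"
  unfolding signed_less_def by auto

locale signed_crt =
  fixes b :: "nat \<Rightarrow> (real \<Rightarrow> real) \<Rightarrow> real" and g :: "real \<Rightarrow> real" and s :: "nat \<Rightarrow> sign"
  assumes crt: "g \<in> crt_excursions"
    and bij: "bij_betw (\<lambda>i. b i g) UNIV (inner_local_minima g)"
begin

abbreviation N :: "real set" where "N \<equiv> not_one_sided_minima g"

lemma excursion: "continuous_excursion g"
  using crt by (rule crt_continuous_excursion)

lemma inj_b: "inj (\<lambda>i. b i g)" and inj_g: "inj_on g (range (\<lambda>i. b i g))"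
  using bij crt unfolding bij_betw_def crt_excursions_def by auto

lemma N_comparable:
  assumes "u \<in> N" "t \<in> N" "u < t"
  obtains i where "unique_min_at b g i u t"
proof -
  obtain w where w: "w \<in> {min t u<..<max t u}" "g w < g u"
    using not_one_sided_minimaE[OF assms(1), of t] assms(3) by blast
  obtain w' where w': "w' \<in> {min u t<..<max u t}" "g w' < g t"
    using not_one_sided_minimaE[OF assms(2), of u] assms(3) by blast
  have "u \<in> {0..1}" "t \<in> {0..1}" using assms not_one_sided_minima_lebesgue(2)[OF crt] by auto
  then show thesis
    using unique_min_at_exists[where b = b, OF crt bij, of u t w w'] that w w' assms(3) by auto
qed

lemma signed_less_total:
  assumes "u \<in> N" "t \<in> N" "u \<noteq> t"
  shows "signed_less b g s u t \<or> signed_less b g s t u"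
proof -
  have *: "signed_less b g s u t \<or> signed_less b g s t u" if ut: "u \<in> N" "t \<in> N" "u < t" for u t
  proof -
    obtain i where i: "unique_min_at b g i u t" using N_comparable[OF ut] .
    show ?thesis
      unfolding signed_less_forward_iff[OF ut(3)] signed_less_backward_iff[OF ut(3)]
      using i by (cases "s i") auto
  qed
  show ?thesis using *[OF assms(1,2)] *[OF assms(2,1)] assms(3) by linarith
qed

lemma signed_less_asym:
  assumes "signed_less b g s u t"
  shows "\<not> signed_less b g s t u"
proof -
  have *: "\<not> (signed_less b g s u t \<and> signed_less b g s t u)" if "u < t" for u t
    unfolding signed_less_forward_iff[OF that] signed_less_backward_iff[OF that]
    using unique_min_at_index[where b = b and g = g, OF inj_b] by (metis sign.distinct(1))
  show ?thesis using *[of u t] *[of t u] assms signed_less_irrefl[of b g s u]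
    by (cases u t rule: linorder_cases) auto
qed

text \<open>Two steps in the same direction of time carry the same sign, so it does not matter which
  of the two minima survives the join.\<close>

lemma signed_less_trans_sorted:
  assumes "x < y" "y < z"
  shows "signed_less b g s x y \<Longrightarrow> signed_less b g s y z \<Longrightarrow> signed_less b g s x z"
    and "signed_less b g s z y \<Longrightarrow> signed_less b g s y x \<Longrightarrow> signed_less b g s z x"
  using unique_min_at_join[where b = b and g = g, OF inj_g] assms
  unfolding signed_less_forward_iff[OF assms(1)] signed_less_forward_iff[OF assms(2)]
    signed_less_backward_iff[OF assms(1)] signed_less_backward_iff[OF assms(2)]
    signed_less_forward_iff[OF order.strict_trans[OF assms]] signed_less_backward_iff[OF order.strict_trans[OF assms]]
  by blast+

text \<open>A failure would be a cycle of three times. Whatever their order in time, two consecutive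
  relations of the cycle pass through the middle time in one direction, and their composition
  contradicts the third.\<close>

lemma signed_less_trans:
  assumes "u \<in> N" "t \<in> N" "v \<in> N" "signed_less b g s u t" "signed_less b g s t v"
  shows "signed_less b g s u v"
proof (rule ccontr)
  assume n: "\<not> signed_less b g s u v"
  have "u \<noteq> v" using assms(4,5) signed_less_asym by blast
  then have vu: "signed_less b g s v u" using signed_less_total[OF assms(1,3)] n by blast
  have "u \<noteq> t" "t \<noteq> v" using assms(4,5) signed_less_irrefl by metis+
  with \<open>u \<noteq> v\<close> consider "u < t" "t < v" | "u < v" "v < t" | "t < u" "u < v"
    | "t < v" "v < u" | "v < u" "u < t" | "v < t" "t < u" by linarith
  then show False
    using signed_less_trans_sorted[of u t v] signed_less_trans_sorted[of u v t]
      signed_less_trans_sorted[of t u v] signed_less_trans_sorted[of t v u]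
      signed_less_trans_sorted[of v u t] signed_less_trans_sorted[of v t u]
      assms(4,5) vu signed_less_asym
    by cases metis+
qed

text \<open>A unique minimum at \<open>b i g\<close> is one condition on the left end and one on the
  right end, each of them open. The relation is thus a countable union of measurable
  rectangles.\<close>

lemma signed_less_sets:
  defines "M \<equiv> lebesgue_on {0..1}"
  shows "{(u, t) \<in> space M \<times> space M. signed_less b g s u t} \<in> sets (M \<Otimes>\<^sub>M M)"
proof -
  define lft where "lft i = {u. u < b i g \<and> (\<forall>z\<in>{u..<b i g}. g (b i g) < g z)}" for i
  define rgt where "rgt i = {u. b i g < u \<and> (\<forall>z\<in>{b i g<..u}. g (b i g) < g z)}" for i
  have near: "\<exists>d>0. \<forall>z. \<bar>z - u\<bar> < d \<longrightarrow> a < g z" if "a < g u" for a u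
  proof -
    have "open {z. a < g z}"
      using excursion_continuous[OF excursion] by (intro open_Collect_less) auto
    then show ?thesis using that unfolding open_dist dist_real_def by auto
  qed
  have "open (lft i)" for i
    unfolding open_dist
  proof
    fix u assume u: "u \<in> lft i"
    then obtain d where d: "d > 0" "\<And>z. \<bar>z - u\<bar> < d \<Longrightarrow> g (b i g) < g z"
      using near[of "g (b i g)" u] unfolding lft_def by auto
    have "y \<in> lft i" if "dist y u < min d (b i g - u)" for y
    proof -
      have "g (b i g) < g z" if "z \<in> {y..<b i g}" for z
        using u d(2)[of z] that \<open>dist y u < _\<close> unfolding lft_def by (cases "z < u") (auto simp: dist_real_def)
      then show ?thesis using that unfolding lft_def by (auto simp: dist_real_def)
    qed
    moreover have "0 < min d (b i g - u)" using d u unfolding lft_def by auto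
    ultimately show "\<exists>e>0. \<forall>y. dist y u < e \<longrightarrow> y \<in> lft i" by blast
  qed
  moreover have "open (rgt i)" for i
    unfolding open_dist
  proof
    fix u assume u: "u \<in> rgt i"
    then obtain d where d: "d > 0" "\<And>z. \<bar>z - u\<bar> < d \<Longrightarrow> g (b i g) < g z"
      using near[of "g (b i g)" u] unfolding rgt_def by auto
    have "y \<in> rgt i" if "dist y u < min d (u - b i g)" for y
    proof -
      have "g (b i g) < g z" if "z \<in> {b i g<..y}" for z
        using u d(2)[of z] that \<open>dist y u < _\<close> unfolding rgt_def by (cases "u < z") (auto simp: dist_real_def)
      then show ?thesis using that unfolding rgt_def by (auto simp: dist_real_def)
    qed
    moreover have "0 < min d (u - b i g)" using d u unfolding rgt_def by auto
    ultimately show "\<exists>e>0. \<forall>y. dist y u < e \<longrightarrow> y \<in> rgt i" by blast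
  qed
  ultimately have lr: "{0..1} \<inter> lft i \<in> sets M" "{0..1} \<inter> rgt i \<in> sets M" for i
    unfolding M_def by (auto simp: sets_restrict_space)
  have um: "unique_min_at b g i u t \<longleftrightarrow> u \<in> lft i \<and> t \<in> rgt i" for i u t
  proof
    assume "unique_min_at b g i u t"
    then show "u \<in> lft i \<and> t \<in> rgt i" unfolding unique_min_at_def lft_def rgt_def by auto
  next
    assume *: "u \<in> lft i \<and> t \<in> rgt i"
    then have "g (b i g) < g z" if "z \<in> {u..t}" "z \<noteq> b i g" for z
      using that unfolding lft_def rgt_def by (cases "z < b i g") auto
    then show "unique_min_at b g i u t" using * unfolding unique_min_at_def lft_def rgt_def by auto
  qed
  have "{(u, t) \<in> space M \<times> space M. signed_less b g s u t} =
      (\<Union>i. if s i = Plus then ({0..1} \<inter> lft i) \<times> ({0..1} \<inter> rgt i)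
        else ({0..1} \<inter> rgt i) \<times> ({0..1} \<inter> lft i))" (is "?L = (\<Union>i. ?R i)")
  proof (intro set_eqI iffI)
    fix p assume "p \<in> ?L"
    then obtain u t where p: "p = (u, t)" "u \<in> {0..1}" "t \<in> {0..1}" "signed_less b g s u t"
      unfolding M_def by (auto simp: space_restrict_space)
    from p(4) consider i where "unique_min_at b g i u t" "s i = Plus" | i where "unique_min_at b g i t u" "s i = Minus"
      unfolding signed_less_def by blast
    then show "p \<in> (\<Union>i. ?R i)"
    proof cases
      case (1 i) then show ?thesis using p um by (intro UN_I[of i]) auto
    next
      case (2 i) then show ?thesis using p um by (intro UN_I[of i]) auto
    qed
  next
    fix p assume "p \<in> (\<Union>i. ?R i)"
    then obtain i where i: "p \<in> ?R i" by blast
    obtain u t where p: "p = (u, t)" by (cases p)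
    have "signed_less b g s u t" "u \<in> {0..1}" "t \<in> {0..1}"
    proof -
      show "u \<in> {0..1}" "t \<in> {0..1}" using i p by (auto split: if_splits)
      show "signed_less b g s u t"
      proof (cases "s i")
        case Plus
        then have "unique_min_at b g i u t" using i p um by auto
        moreover have "u < t" using calculation unfolding unique_min_at_def by auto
        ultimately show ?thesis using Plus unfolding signed_less_def by blast
      next
        case Minus
        then have "unique_min_at b g i t u" using i p um by auto
        moreover have "t < u" using calculation unfolding unique_min_at_def by auto
        ultimately show ?thesis using Minus unfolding signed_less_def by blast
      qed
    qed
    then show "p \<in> ?L" unfolding p M_def by (simp add: space_restrict_space)
  qed
  moreover have "?R i \<in> sets (M \<Otimes>\<^sub>M M)" for i using lr by auto
  then have "(\<Union>i. ?R i) \<in> sets (M \<Otimes>\<^sub>M M)" by (intro sets.countable_UN) blast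
  ultimately show ?thesis by (simp only:)
qed

lemma random_order: "random_order (lebesgue_on {0..1}) (signed_less b g s) N"
proof -
  interpret prob_space "lebesgue_on {0..1::real}" by (rule prob_space_unit_interval)
  note N = not_one_sided_minima_lebesgue[OF crt]
  show ?thesis
  proof
    show N_ev: "N \<in> events" using N by (simp add: sets_restrict_space_iff)
    show "prob N = 1"
      using crt N(1,2) unfolding crt_excursions_def
      by (subst measure_restrict_space) (auto simp: measure_def)
    show "{t} \<in> events \<and> prob {t} = 0" if "t \<in> N" for t
      using that N(2) by (auto simp: sets_restrict_space_iff measure_restrict_space)
  qed (use signed_less_sets signed_less_total signed_less_asym signed_less_trans in blast)+
qed

sublocale random_order "lebesgue_on {0..1}" "signed_less b g s" N
  by (rule random_order)

lemma varphi_eq_rank: "varphi b g s t = rank t"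
  unfolding varphi_def rank_def by (subst measure_restrict_space) (auto simp: space_restrict_space)

abbreviation \<phi> :: "real \<Rightarrow> real" where "\<phi> \<equiv> varphi b g s"

lemma varphi_measurable: "\<phi> \<in> borel_measurable (lebesgue_on {0..1})"
  unfolding varphi_eq_rank[abs_def] by (rule rank_measurable)

lemma varphi_unit: "\<phi> t \<in> {0..1}"
  unfolding varphi_eq_rank rank_def by auto

lemma varphi_mono: "u \<in> N \<Longrightarrow> t \<in> N \<Longrightarrow> signed_less b g s u t \<Longrightarrow> \<phi> u \<le> \<phi> t"
  unfolding varphi_eq_rank by (rule rank_mono)

lemma emeasure_varphi_vimage:
  assumes "A \<in> sets borel"
  shows "emeasure (lebesgue_on {0..1}) {t \<in> {0..1}. \<phi> t \<in> A} = emeasure (lebesgue_on {0..1}) ({0..1} \<inter> A)"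
proof -
  have id: "(\<lambda>x. x) \<in> borel_measurable (lebesgue_on {0..1::real})"
    by (intro measurable_restrict_space1 measurable_completion) simp
  have "emeasure (distr (lebesgue_on {0..1}) borel \<phi>) A = emeasure (distr (lebesgue_on {0..1}) borel (\<lambda>x. x)) A"
    unfolding varphi_eq_rank[abs_def] distr_rank ..
  then show ?thesis
    unfolding emeasure_distr[OF varphi_measurable assms] emeasure_distr[OF id assms]
    by (simp add: space_restrict_space vimage_def Int_def conj_commute)
qed

end

section \<open>Genealogy and isomorphisms\<close>

lemma null_complement_dense:
  assumes "y \<in> {0..1::real}" "0 < r" "B \<in> null_sets lebesgue"
  obtains t where "t \<in> {0..1} - B" "\<bar>t - y\<bar> < r"
proof -
  have "\<exists>t\<in>{0..1} - B. \<bar>t - y\<bar> < r"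
  proof (rule ccontr)
    assume n: "\<not> (\<exists>t\<in>{0..1} - B. \<bar>t - y\<bar> < r)"
    \<comment> \<open>Truncation to the unit interval leaves an open interval of positive length
      even when \<open>y\<close> is an endpoint.\<close>
    define W where "W = {max 0 (y - r)<..<min 1 (y + r)}"
    have "W \<subseteq> B"
    proof
      fix t assume "t \<in> W"
      then have "t \<in> {0..1}" "\<bar>t - y\<bar> < r" unfolding W_def by (simp_all add: abs_less_iff)
      then show "t \<in> B" using n by blast
    qed
    moreover have "W \<in> sets lebesgue" unfolding W_def by simp
    ultimately have "W \<in> null_sets lebesgue"
      by (intro null_sets_subset[OF assms(3)])
    moreover have lt: "max 0 (y - r) < min 1 (y + r)" using assms(1,2) by auto
    have "emeasure lebesgue W = ennreal (min 1 (y + r) - max 0 (y - r))"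
      unfolding W_def using less_imp_le[OF lt] by (simp del: max_less_iff_conj min_less_iff_conj)
    ultimately have "ennreal (min 1 (y + r) - max 0 (y - r)) = 0"
      by (metis null_setsD1)
    then have "min 1 (y + r) - max 0 (y - r) \<le> 0" by (rule ennreal_eq_0_iff[THEN iffD1])
    with lt show False by linarith
  qed
  then show thesis using that by blast
qed

section \<open>Ancestors in the tree and the time spans of classes\<close>

lemma excursion_level_right:
  assumes ce: "continuous_excursion g" and "y \<in> {0..1}" "0 \<le> a" "a \<le> g y"
  obtains z where "z \<in> {y..1}" "g z = a" "\<And>w. w \<in> {y..z} \<Longrightarrow> a \<le> g w"
proof -
  have cont: "continuous_on A g" for A
    by (rule continuous_on_subset[OF excursion_continuous[OF ce] subset_UNIV])
  define C where "C = {z \<in> {y..1}. g z = a}"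
  have "C = {y..1} \<inter> {z. g z = a}" unfolding C_def by auto
  moreover have "closed {z. g z = a}" using cont by (intro closed_Collect_eq) auto
  ultimately have "compact C" by (auto intro: compact_Int_closed)
  have "\<exists>z. y \<le> z \<and> z \<le> 1 \<and> g z = a"
    using assms ce cont unfolding continuous_excursion_def by (intro IVT2') auto
  then have "C \<noteq> {}" unfolding C_def by auto
  then obtain z where z: "z \<in> C" "\<And>w. w \<in> C \<Longrightarrow> z \<le> w"
    using compact_attains_inf[OF \<open>compact C\<close>] by metis
  \<comment> \<open>As \<open>z\<close> is the first visit to level \<open>a\<close> after
    \<open>y\<close>, a dip below \<open>a\<close> on the way would by continuity give an earlier
    one.\<close>
  have "a \<le> g w" if w: "w \<in> {y..z}" for w
  proof (rule ccontr)
    assume "\<not> a \<le> g w"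
    then obtain v where v: "y \<le> v" "v \<le> w" "g v = a"
      using IVT2'[of g w a y] assms w cont by auto
    then have "v \<in> C" using z(1) w unfolding C_def by auto
    then have "v = w" using z(2)[of v] v w by auto
    then show False using v(3) \<open>\<not> a \<le> g w\<close> by simp
  qed
  then show thesis using z(1) that unfolding C_def by auto
qed

lemma excursion_level_left:
  assumes ce: "continuous_excursion g" and "y \<in> {0..1}" "0 \<le> a" "a \<le> g y"
  obtains z where "z \<in> {0..y}" "g z = a" "\<And>w. w \<in> {z..y} \<Longrightarrow> a \<le> g w"
proof -
  have cont: "continuous_on A g" for A
    by (rule continuous_on_subset[OF excursion_continuous[OF ce] subset_UNIV])
  define C where "C = {z \<in> {0..y}. g z = a}"
  have "C = {0..y} \<inter> {z. g z = a}" unfolding C_def by auto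
  moreover have "closed {z. g z = a}" using cont by (intro closed_Collect_eq) auto
  ultimately have "compact C" by (auto intro: compact_Int_closed)
  have "\<exists>z. 0 \<le> z \<and> z \<le> y \<and> g z = a"
    using assms ce cont unfolding continuous_excursion_def by (intro IVT') auto
  then have "C \<noteq> {}" unfolding C_def by auto
  then obtain z where z: "z \<in> C" "\<And>w. w \<in> C \<Longrightarrow> w \<le> z"
    using compact_attains_sup[OF \<open>compact C\<close>] by metis
  have "a \<le> g w" if w: "w \<in> {z..y}" for w
  proof (rule ccontr)
    assume "\<not> a \<le> g w"
    then obtain v where v: "w \<le> v" "v \<le> y" "g v = a"
      using IVT'[of g w a y] assms w cont by auto
    then have "v \<in> C" using z(1) w unfolding C_def by auto
    then have "v = w" using z(2)[of v] v w by auto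
    then show False using v(3) \<open>\<not> a \<le> g w\<close> by simp
  qed
  then show thesis using z(1) that unfolding C_def by auto
qed

text \<open>The point \<open>X\<close> lies on the segment from the root to \<open>Y\<close>. Only
  metric and root enter, so root preserving isometries respect the relation.\<close>

definition tree_ancestor :: "(real \<Rightarrow> real) \<Rightarrow> real set \<Rightarrow> real set \<Rightarrow> bool" where
  "tree_ancestor g X Y \<longleftrightarrow>
     tree_dist g (tree_proj g 0) X + tree_dist g X Y = tree_dist g (tree_proj g 0) Y"

lemma tree_ancestor_iff:
  assumes "continuous_excursion g" "X \<in> tree_points g" "Y \<in> tree_points g" "x \<in> X" "y \<in> Y"
  shows "tree_ancestor g X Y \<longleftrightarrow> x \<in> ancestor_times g y"
proof -
  have "0 \<in> tree_proj g 0" by (simp add: mem_tree_proj_iff)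
  then have "tree_dist g (tree_proj g 0) X = pseudo_dist g 0 x" "tree_dist g (tree_proj g 0) Y = pseudo_dist g 0 y"
    using assms by (intro tree_dist_eq[OF assms(1)]; simp)+
  then show ?thesis
    using tree_point_eq_proj(1)[OF assms(1,2,4)]
    unfolding tree_ancestor_def ancestor_times_def tree_dist_eq[OF assms] by simp
qed

text \<open>On either side of \<open>y\<close> the path reaches the height of \<open>X\<close> again
  without having gone below it, and both of these visits belong to \<open>X\<close>.\<close>

lemma tree_ancestor_Inf_Sup:
  assumes ce: "continuous_excursion g" and X: "X \<in> tree_points g" and Y: "Y \<in> tree_points g"
    and anc: "tree_ancestor g X Y" and y: "y \<in> Y"
  shows "Inf X \<le> y" "y \<le> Sup X"
proof -
  obtain x where x: "x \<in> X" using tree_point_compact[OF ce X] by blast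
  have xI: "x \<in> {0..1}" "X = tree_proj g x" and yI: "y \<in> {0..1}"
    using tree_point_eq_proj[OF ce X x] tree_point_eq_proj[OF ce Y y] by auto
  have le: "g x \<le> g w" if "w \<in> {min x y..max x y}" for w
    using anc that unfolding tree_ancestor_iff[OF ce X Y x y] mem_ancestor_times_iff[OF ce] by blast
  then have "g x \<le> g y" by auto
  have mem: "z \<in> X" if m: "z \<in> {0..1}" "g z = g x" "\<And>w. w \<in> {min y z..max y z} \<Longrightarrow> g x \<le> g w" for z
  proof -
    have "g x \<le> g w" if w: "w \<in> {min x z..max x z}" for w
    proof -
      have "w \<in> {min x y..max x y} \<or> w \<in> {min y z..max y z}"
        using w by (auto simp: min_def max_def split: if_splits)
      then show ?thesis using le m(3) by blast
    qed
    then show ?thesis using m(1,2) xI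
      by (simp add: mem_tree_proj_iff pseudo_dist_zero_iff[OF ce])
  qed
  obtain z where z: "z \<in> {y..1}" "g z = g x" "\<And>w. w \<in> {y..z} \<Longrightarrow> g x \<le> g w"
    using excursion_level_right[OF ce yI excursion_nonneg[OF ce] \<open>g x \<le> g y\<close>] by metis
  then have "z \<in> X" using yI by (intro mem) auto
  then show "y \<le> Sup X" using tree_point_Inf_Sup(4)[OF ce X] z(1) by fastforce
  obtain z' where z': "z' \<in> {0..y}" "g z' = g x" "\<And>w. w \<in> {z'..y} \<Longrightarrow> g x \<le> g w"
    using excursion_level_left[OF ce yI excursion_nonneg[OF ce] \<open>g x \<le> g y\<close>] by metis
  then have "z' \<in> X" using yI by (intro mem) auto
  then show "Inf X \<le> y" using tree_point_Inf_Sup(3)[OF ce X] z'(1) by fastforce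
qed

text \<open>Between the first and the last visit to \<open>X\<close> the path never goes below the
  height of \<open>X\<close>.\<close>

lemma between_class_ancestor:
  assumes ce: "continuous_excursion g" and X: "X \<in> tree_points g" and Y: "Y \<in> tree_points g"
    and y: "y \<in> Y" "Inf X \<le> y" "y \<le> Sup X"
  shows "tree_ancestor g X Y"
proof -
  note IX = tree_point_Inf_Sup[OF ce X]
  have "Sup X \<in> tree_proj g (Inf X)" using tree_point_eq_proj(2)[OF ce X IX(1)] IX(2) by simp
  then have "g (Inf X) \<le> g z" if "z \<in> {Inf X..Sup X}" for z
    using that y unfolding mem_tree_proj_iff pseudo_dist_zero_iff[OF ce] by auto
  then have "Inf X \<in> ancestor_times g y"
    using tree_point_eq_proj(1)[OF ce X IX(1)] y(2,3) unfolding mem_ancestor_times_iff[OF ce] by auto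
  then show ?thesis using tree_ancestor_iff[OF ce X Y IX(1) y(1)] by simp
qed

text \<open>If the time spans of two classes met, one of them would contain the first visit of the
  other, which is an ancestral relation.\<close>

lemma not_ancestor_cases:
  assumes ce: "continuous_excursion g" and X: "X \<in> tree_points g" and Y: "Y \<in> tree_points g"
    and "\<not> tree_ancestor g X Y" "\<not> tree_ancestor g Y X"
  shows "Sup X < Inf Y \<or> Sup Y < Inf X"
proof -
  have "\<not> (Inf X \<le> Inf Y \<and> Inf Y \<le> Sup X)" "\<not> (Inf Y \<le> Inf X \<and> Inf X \<le> Sup Y)"
    using between_class_ancestor[OF ce X Y tree_point_Inf_Sup(1)[OF ce Y]]
      between_class_ancestor[OF ce Y X tree_point_Inf_Sup(1)[OF ce X]] assms(4,5) by blast+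
  then show ?thesis by linarith
qed

lemma tree_le_antisym:
  assumes ce: "continuous_excursion g" and X: "X \<in> tree_points g" and Y: "Y \<in> tree_points g"
    and "Inf X = Inf Y"
  shows "X = Y"
  using tree_point_Inf_Sup(1)[OF ce X] tree_point_Inf_Sup(1)[OF ce Y] assms(4)
    tree_point_eqI[OF ce X Y] by simp

lemma isometry_measurable:
  assumes g: "continuous_excursion g" and h: "continuous_excursion h"
    and k: "k \<in> tree_points g \<rightarrow> tree_points h"
      "\<And>X Y. X \<in> tree_points g \<Longrightarrow> Y \<in> tree_points g \<Longrightarrow> tree_dist h (k X) (k Y) = tree_dist g X Y"
  shows "k \<in> tree_borel g \<rightarrow>\<^sub>M tree_borel h"
proof (rule tree_borel_measurable_into[OF h])
  interpret G: Metric_space "tree_points g" "tree_dist g" by (rule tree_metric[OF g])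
  interpret H: Metric_space "tree_points h" "tree_dist h" by (rule tree_metric[OF h])
  show "k \<in> space (tree_borel g) \<rightarrow> tree_points h" using k(1) by simp
  fix U assume U: "openin H.mtopology U"
  have "continuous_map G.mtopology H.mtopology k"
    unfolding G.metric_continuous_map[OF tree_metric[OF h]]
    using k by (auto simp: image_subset_iff Pi_iff)
  then have "openin G.mtopology {X \<in> tree_points g. k X \<in> U}"
    using U openin_continuous_map_preimage by fastforce
  moreover have "k -` U \<inter> space (tree_borel g) = {X \<in> tree_points g. k X \<in> U}" by auto
  ultimately show "k -` U \<inter> space (tree_borel g) \<in> sets (tree_borel g)"
    using tree_borel_open[OF g] by simp
qed

lemma signed_tree_space_sel [simp]:
  "pom_points (signed_tree_space b g s) = tree_points g"
  "pom_dist (signed_tree_space b g s) = tree_dist g"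
  "pom_root (signed_tree_space b g s) = tree_proj g 0"
  "pom_le (signed_tree_space b g s) = signed_tree_le b g s"
  "pom_measure (signed_tree_space b g s) = tree_measure g"
  "pom_points (tree_space g) = tree_points g"
  "pom_dist (tree_space g) = tree_dist g"
  "pom_root (tree_space g) = tree_proj g 0"
  "pom_le (tree_space g) = tree_le g"
  "pom_measure (tree_space g) = tree_measure g"
  unfolding signed_tree_space_def tree_space_def by simp_all

context signed_crt
begin

lemma N_dense:
  assumes "y \<in> {0..1}" "0 < r"
  obtains t where "t \<in> N" "\<bar>t - y\<bar> < r"
proof -
  obtain t where "t \<in> {0..1} - ({0..1} - N)" "\<bar>t - y\<bar> < r"
    using null_complement_dense[OF assms not_one_sided_minima_lebesgue(3)[OF crt]] by metis
  then show thesis using that by blast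
qed

text \<open>The inequalities at the ends are strict and survive small moves. A comparison of classes
  can therefore be tested at nearby times in \<open>N\<close>.\<close>

lemma unique_min_at_nearby:
  assumes "unique_min_at b g i x y"
  obtains d where "0 < d" "\<And>z w. \<bar>z - x\<bar> < d \<Longrightarrow> \<bar>w - y\<bar> < d \<Longrightarrow> unique_min_at b g i z w"
proof -
  have u: "b i g \<in> {x<..<y}" "\<And>z. z \<in> {x..y} \<Longrightarrow> z \<noteq> b i g \<Longrightarrow> g (b i g) < g z"
    using assms unfolding unique_min_at_def by auto
  have "open {z. g (b i g) < g z}"
    using excursion_continuous[OF excursion] by (intro open_Collect_less) auto
  moreover have "x \<in> {z. g (b i g) < g z}" "y \<in> {z. g (b i g) < g z}" using u by auto
  ultimately obtain d1 d2 where d: "d1 > 0" "\<And>z. \<bar>z - x\<bar> < d1 \<Longrightarrow> g (b i g) < g z"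
    "d2 > 0" "\<And>z. \<bar>z - y\<bar> < d2 \<Longrightarrow> g (b i g) < g z"
    unfolding open_dist dist_real_def by (metis mem_Collect_eq)
  define d where "d = min (min d1 d2) (min (b i g - x) (y - b i g))"
  have "unique_min_at b g i z w" if zw: "\<bar>z - x\<bar> < d" "\<bar>w - y\<bar> < d" for z w
  proof -
    have "g (b i g) < g v" if "v \<in> {z..w}" "v \<noteq> b i g" for v
    proof -
      consider "v < x" | "v \<in> {x..y}" | "y < v" by fastforce
      then show ?thesis
      proof cases
        case 1 then show ?thesis using that zw unfolding d_def by (intro d(2)) auto
      next
        case 2 then show ?thesis using u(2) that by blast
      next
        case 3 then show ?thesis using that zw unfolding d_def by (intro d(4)) auto
      qed
    qed
    then show ?thesis using zw u(1) unfolding unique_min_at_def d_def by auto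
  qed
  moreover have "0 < d" unfolding d_def using d u(1) by auto
  ultimately show thesis using that by blast
qed

text \<open>For an isomorphism \<open>k\<close>, the leftmost time \<open>Inf (k X)\<close> is the mass of the points below \<open>X\<close>,
  because almost all times of the target have a singleton class.\<close>

lemma isomorphism_facts:
  assumes h: "continuous_excursion h"
    and iso: "pom_isomorphism k (signed_tree_space b g s) (tree_space h)"
  shows "\<And>z. z \<in> {0..1} \<Longrightarrow> ancestor_times h z \<in> null_sets lborel"
    and "\<And>X. X \<in> tree_points g \<Longrightarrow>
      Inf (k X) = measure (tree_measure g) {Y \<in> tree_points g. signed_tree_le b g s Y X}"
    and "\<And>X. X \<in> tree_points g \<Longrightarrow> h (Inf (k X)) = tree_dist g (tree_proj g 0) X"
proof -
  have k: "bij_betw k (tree_points g) (tree_points h)"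
    and kdist: "\<And>X Y. X \<in> tree_points g \<Longrightarrow> Y \<in> tree_points g \<Longrightarrow> tree_dist h (k X) (k Y) = tree_dist g X Y"
    and kroot: "k (tree_proj g 0) = tree_proj h 0"
    and kle: "\<And>X Y. X \<in> tree_points g \<Longrightarrow> Y \<in> tree_points g \<Longrightarrow> signed_tree_le b g s X Y \<Longrightarrow> tree_le h (k X) (k Y)"
    and kmeas: "k \<in> tree_measure g \<rightarrow>\<^sub>M tree_measure h"
    and kdistr: "distr (tree_measure g) (tree_measure h) k = tree_measure h"
    using iso unfolding pom_isomorphism_def by auto
  have kin: "k X \<in> tree_points h" if "X \<in> tree_points g" for X
    using k that unfolding bij_betw_def by blast
  have em: "emeasure (tree_measure h) A = emeasure (tree_measure g) (k -` A \<inter> tree_points g)"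
    if "A \<in> sets (tree_borel h)" for A
    using that kmeas by (subst kdistr[symmetric]) (simp add: emeasure_distr)
  show anc: "ancestor_times h z \<in> null_sets lborel" if z: "z \<in> {0..1}" for z
  proof -
    define A where "A = tree_proj h ` ancestor_times h z"
    have A: "A \<in> sets (tree_borel h)" unfolding A_def
      by (intro tree_image_compact_borel h ancestor_times_compact ancestor_times_subset)
    have kA: "k -` A \<inter> tree_points g \<in> sets (tree_borel g)"
      using measurable_sets[OF kmeas, of A] A by simp
    obtain Z where Z: "Z \<in> tree_points g" "k Z = tree_proj h z"
      using k tree_proj_in[OF z, of h] unfolding bij_betw_def by (metis imageE)
    obtain z0 where z0: "z0 \<in> Z" using tree_point_compact[OF excursion Z(1)] by blast
    have z0I: "z0 \<in> {0..1}" "Z = tree_proj g z0" using tree_point_eq_proj[OF excursion Z(1) z0] by auto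
    \<comment> \<open>The set of ancestor times is a union of classes, so its Lebesgue measure is
      the tree mass of its image \<open>A\<close>.\<close>
    have eq: "ancestor_times h z = {t \<in> {0..1}. tree_proj h t \<in> A}"
    proof (intro set_eqI iffI)
      fix t assume "t \<in> ancestor_times h z"
      then show "t \<in> {t \<in> {0..1}. tree_proj h t \<in> A}"
        using ancestor_times_subset unfolding A_def by blast
    next
      fix t assume "t \<in> {t \<in> {0..1}. tree_proj h t \<in> A}"
      then obtain t' where t': "t \<in> {0..1}" "t' \<in> ancestor_times h z" "tree_proj h t = tree_proj h t'"
        unfolding A_def by auto
      then have p: "pseudo_dist h t t' = 0"
        using tree_proj_eq_iff[OF h] ancestor_times_subset by blast
      show "t \<in> ancestor_times h z"
        using t'(1,2) pseudo_dist_zero_cong[OF h p pseudo_dist_self, of z]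
          pseudo_dist_zero_cong[OF h pseudo_dist_self p, of 0]
        unfolding ancestor_times_def by simp
    qed
    \<comment> \<open>Pulled back by the isometry, \<open>A\<close> consists of ancestors of
      \<open>Z\<close> in the source tree, where the CRT property makes them null.\<close>
    have "{t \<in> {0..1}. tree_proj g t \<in> k -` A \<inter> tree_points g} \<subseteq> ancestor_times g z0"
    proof
      fix t assume t: "t \<in> {t \<in> {0..1}. tree_proj g t \<in> k -` A \<inter> tree_points g}"
      then obtain t' where t': "t' \<in> ancestor_times h z" "k (tree_proj g t) = tree_proj h t'" "t' \<in> {0..1}"
        using ancestor_times_subset unfolding A_def by blast
      have "tree_dist h (tree_proj h 0) (tree_proj h t') + tree_dist h (tree_proj h t') (tree_proj h z)
          = tree_dist h (tree_proj h 0) (tree_proj h z)"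
        using t'(1,3) z unfolding ancestor_times_def by (simp add: tree_dist_proj[OF h])
      then have "tree_dist h (k (tree_proj g 0)) (k (tree_proj g t)) + tree_dist h (k (tree_proj g t)) (k (tree_proj g z0))
          = tree_dist h (k (tree_proj g 0)) (k (tree_proj g z0))"
        using t'(2) Z(2) z0I(2) kroot by simp
      then show "t \<in> ancestor_times g z0"
        using t z0I(1) unfolding ancestor_times_def by (simp add: kdist tree_dist_proj[OF excursion])
    qed
    moreover have null: "ancestor_times g z0 \<in> null_sets lborel"
      by (rule crt_ancestor_times_null[OF crt])
    ultimately have "emeasure (lebesgue_on {0..1}) {t \<in> {0..1}. tree_proj g t \<in> k -` A \<inter> tree_points g}
        \<le> emeasure (lebesgue_on {0..1}) (ancestor_times g z0)"
      using ancestor_times_subset by (intro emeasure_mono) (auto simp: sets_restrict_space_iff null_sets_def)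
    also have "\<dots> = 0"
      using null ancestor_times_subset[of g z0]
      by (subst emeasure_restrict_space) (auto simp: null_sets_def)
    finally have "emeasure (lebesgue_on {0..1}) (ancestor_times h z) = 0"
      unfolding eq emeasure_tree_measure[OF h A, symmetric] em[OF A]
      by (simp add: emeasure_tree_measure[OF excursion kA])
    then have "emeasure lebesgue (ancestor_times h z) = 0"
      using ancestor_times_subset[of h z] by (subst (asm) emeasure_restrict_space) auto
    then show ?thesis
      using borel_compact[OF ancestor_times_compact[OF h, of z]] by (auto simp: null_sets_def)
  qed
  fix X assume X: "X \<in> tree_points g"
  note IX = tree_point_Inf_Sup[OF h kin[OF X]]
  define c where "c = Inf (k X)"
  have c: "c \<in> {0..1}" using tree_point_eq_proj(1)[OF h kin[OF X] IX(1)] unfolding c_def .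
  have "tree_dist g (tree_proj g 0) X = tree_dist h (tree_proj h 0) (k X)"
    using kdist[OF _ X, of "tree_proj g 0"] kroot by simp
  also have "\<dots> = pseudo_dist h 0 c"
    using IX(1) kin[OF X] unfolding c_def
    by (intro tree_dist_eq[OF h]) (auto simp: mem_tree_proj_iff)
  also have "\<dots> = h c" by (rule pseudo_dist_0[OF h])
  finally show "h (Inf (k X)) = tree_dist g (tree_proj g 0) X" unfolding c_def by simp
  \<comment> \<open>As the image of a compact interval \<open>A\<close> is measurable, and it
    consists of the classes first visited by time \<open>c\<close>.\<close>
  define A where "A = tree_proj h ` {0..c}"
  have A: "A \<in> sets (tree_borel h)"
    unfolding A_def using c by (intro tree_image_compact_borel h) auto
  have kA: "k -` A \<inter> tree_points g \<in> sets (tree_borel g)"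
    using measurable_sets[OF kmeas, of A] A by simp
  have A_iff: "Y \<in> A \<longleftrightarrow> Inf Y \<le> c" if Y: "Y \<in> tree_points h" for Y
  proof
    note IY = tree_point_Inf_Sup[OF h Y]
    show "Inf Y \<le> c" if "Y \<in> A"
    proof -
      from that obtain t where "t \<in> {0..c}" "Y = tree_proj h t" unfolding A_def by blast
      moreover then have "t \<in> Y" using c by (auto simp: mem_tree_proj_iff)
      ultimately show ?thesis using IY(3)[of t] by auto
    qed
    show "Y \<in> A" if "Inf Y \<le> c"
      using that tree_point_eq_proj[OF h Y IY(1)] unfolding A_def by (intro image_eqI[of _ _ "Inf Y"]) auto
  qed
  have "k -` A \<inter> tree_points g = {Y \<in> tree_points g. signed_tree_le b g s Y X}"
  proof (intro set_eqI iffI)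
    fix Y assume "Y \<in> {Y \<in> tree_points g. signed_tree_le b g s Y X}"
    then show "Y \<in> k -` A \<inter> tree_points g"
      using kle[OF _ X] A_iff[OF kin] unfolding tree_le_def c_def by auto
  next
    \<comment> \<open>Order preservation is assumed in one direction only; totality of the signed
      order and injectivity of \<open>k\<close> give the converse.\<close>
    fix Y assume Y: "Y \<in> k -` A \<inter> tree_points g"
    then have le: "Inf (k Y) \<le> Inf (k X)" using A_iff[OF kin] unfolding c_def by auto
    have "signed_tree_le b g s Y X"
    proof (rule ccontr)
      assume n: "\<not> signed_tree_le b g s Y X"
      then have "signed_tree_le b g s X Y"
        unfolding signed_tree_le_def tree_le_def by linarith
      then have "Inf (k X) \<le> Inf (k Y)" using kle[OF X, of Y] Y unfolding tree_le_def by auto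
      then have "k X = k Y" using tree_le_antisym[OF h kin kin, of X Y] le X Y by auto
      then have "X = Y" using k X Y unfolding bij_betw_def inj_on_def by auto
      moreover have "\<not> tree_swapped b g s X X"
        using tree_point_Inf_Sup[OF excursion X] unfolding tree_swapped_def by force
      ultimately show False using n unfolding signed_tree_le_def tree_le_def by simp
    qed
    then show "Y \<in> {Y \<in> tree_points g. signed_tree_le b g s Y X}" using Y by simp
  qed
  then have "emeasure (tree_measure g) {Y \<in> tree_points g. signed_tree_le b g s Y X} = emeasure (tree_measure h) A"
    using em[OF A] by simp
  also have "\<dots> = emeasure (lebesgue_on {0..1}) {t \<in> {0..1}. tree_proj h t \<in> A}"
    by (rule emeasure_tree_measure[OF h A])
  also have "\<dots> = emeasure (lebesgue_on {0..1}) {0..c}"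
  proof (rule emeasure_eq_AE)
    \<comment> \<open>Off a null set the class of \<open>t\<close> is \<open>{t}\<close>, with first
      visit \<open>t\<close>, so membership in \<open>A\<close> reads
      \<open>t \<le> c\<close>.\<close>
    obtain B where B: "B \<in> null_sets lborel" "\<And>t. t \<in> {0..1} - B \<Longrightarrow> tree_proj h t = {t}"
      using singleton_classes[OF h anc] by metis
    have "B \<in> null_sets lebesgue" using B(1) by (rule null_sets_completionI)
    then have "AE t in lebesgue. t \<notin> B" by (rule AE_not_in)
    then have "AE t in lebesgue. t \<in> {0..1} \<longrightarrow> (t \<in> {t \<in> {0..1}. tree_proj h t \<in> A} \<longleftrightarrow> t \<in> {0..c})"
    proof eventually_elim
      case (elim t)
      have "tree_proj h t \<in> A \<longleftrightarrow> t \<in> {0..c}" if "t \<in> {0..1}"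
        using A_iff[OF tree_proj_in[OF that]] B(2)[of t] elim that by simp
      then show ?case by blast
    qed
    then show "AE t in lebesgue_on {0..1}. t \<in> {t \<in> {0..1}. tree_proj h t \<in> A} \<longleftrightarrow> t \<in> {0..c}"
      by (subst AE_restrict_space_iff) auto
    have "{t \<in> {0..1}. tree_proj h t \<in> A} = tree_proj h -` A \<inter> space (lebesgue_on {0..1})"
      by (auto simp: space_restrict_space)
    then show "{t \<in> {0..1}. tree_proj h t \<in> A} \<in> sets (lebesgue_on {0..1})"
      using measurable_sets[OF lebesgue_on_measurable_from_borel[OF tree_proj_measurable[OF h]] A] by simp
    show "{0..c} \<in> sets (lebesgue_on {0..1})" using c by (simp add: sets_restrict_space_iff)
  qed
  also have "\<dots> = ennreal c"
    using c by (subst emeasure_restrict_space) auto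
  finally show "Inf (k X) = measure (tree_measure g) {Y \<in> tree_points g. signed_tree_le b g s Y X}"
    unfolding c_def[symmetric] measure_def using c by simp
qed

text \<open>First visit and height of \<open>k X\<close> are computed from the source alone. Almost
  every time of the target is the first visit of a singleton class, so the two excursions agree
  almost everywhere, hence everywhere by continuity.\<close>

lemma isomorphism_unique:
  assumes h: "continuous_excursion h" "continuous_excursion h'"
    and iso: "pom_isomorphism k (signed_tree_space b g s) (tree_space h)"
      "pom_isomorphism k' (signed_tree_space b g s) (tree_space h')"
  shows "h = h'" and "X \<in> tree_points g \<Longrightarrow> k X = k' X"
proof -
  note F = isomorphism_facts[OF h(1) iso(1)] and F' = isomorphism_facts[OF h(2) iso(2)]
  have k: "bij_betw k (tree_points g) (tree_points h)" and k': "bij_betw k' (tree_points g) (tree_points h')"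
    using iso unfolding pom_isomorphism_def by auto
  obtain B where B: "B \<in> null_sets lborel" "\<And>t. t \<in> {0..1} - B \<Longrightarrow> tree_proj h t = {t}"
    using singleton_classes[OF h(1) F(1)] by metis
  have eq: "h t = h' t" if t: "t \<in> {0..1} - B" for t
  proof -
    obtain X where X: "X \<in> tree_points g" "k X = {t}"
      using k B(2)[OF t] tree_proj_in[of t h] t unfolding bij_betw_def by (metis DiffD1 imageE)
    then have "Inf (k X) = t" by simp
    then show ?thesis using F(2,3)[OF X(1)] F'(2,3)[OF X(1)] by simp
  qed
  show hh: "h = h'"
  proof
    fix y
    show "h y = h' y"
    proof (cases "y \<in> {0..1}")
      case False
      then show ?thesis using h unfolding continuous_excursion_def by simp
    next
      case True
      show ?thesis
      proof (rule ccontr)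
        assume "h y \<noteq> h' y"
        moreover have "open {t. h t \<noteq> h' t}"
          using h excursion_continuous by (intro open_Collect_neq) auto
        ultimately obtain r where r: "0 < r" "\<And>t. \<bar>t - y\<bar> < r \<Longrightarrow> h t \<noteq> h' t"
          unfolding open_dist dist_real_def by auto
        obtain t where "t \<in> {0..1} - B" "\<bar>t - y\<bar> < r"
          using null_complement_dense[OF True r(1) null_sets_completionI[OF B(1)]] by metis
        then show False using r(2) eq by blast
      qed
    qed
  qed
  assume X: "X \<in> tree_points g"
  then have "k X \<in> tree_points h" "k' X \<in> tree_points h"
    using k k' unfolding bij_betw_def hh by auto
  then show "k X = k' X"
    using F(2)[OF X] F'(2)[OF X] by (intro tree_le_antisym[OF h(1)]) auto
qed

end

section \<open>The isomorphism induced by \<open>\<phi>\<close>\<close>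

locale signed_crt_pair = signed_crt +
  fixes h :: "real \<Rightarrow> real"
  assumes crt_h: "h \<in> crt_excursions"
    and dist_varphi: "\<And>x y. x \<in> {0..1} \<Longrightarrow> y \<in> {0..1} \<Longrightarrow>
      pseudo_dist h (varphi b g s x) (varphi b g s y) = pseudo_dist g x y"
    and level_varphi: "\<And>x. x \<in> {0..1} \<Longrightarrow> h (varphi b g s x) = g x"
begin

lemma excursion_h: "continuous_excursion h"
  using crt_h by (rule crt_continuous_excursion)

abbreviation \<j> :: "real set \<Rightarrow> real set" where "\<j> \<equiv> jmap b g s h"

text \<open>The value at a class is computed at its first visit; identified times have identified
  images because \<open>\<phi>\<close> preserves pseudo-distances. Extensionality then makes the
  definite description meaningful.\<close>

lemma jmap_spec:
  "\<j> \<in> tree_points g \<rightarrow>\<^sub>E tree_points h \<and> (\<forall>t\<in>{0..1}. \<j> (tree_proj g t) = tree_proj h (\<phi> t))"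
proof -
  let ?P = "\<lambda>j. j \<in> tree_points g \<rightarrow>\<^sub>E tree_points h \<and> (\<forall>t\<in>{0..1}. j (tree_proj g t) = tree_proj h (\<phi> t))"
  define j where "j = (\<lambda>X\<in>tree_points g. tree_proj h (\<phi> (Inf X)))"
  have "j (tree_proj g t) = tree_proj h (\<phi> t)" if t: "t \<in> {0..1}" for t
  proof -
    note I = tree_point_Inf_Sup(1)[OF excursion tree_proj_in[OF t]]
    then have "Inf (tree_proj g t) \<in> {0..1}" "pseudo_dist g t (Inf (tree_proj g t)) = 0"
      unfolding mem_tree_proj_iff by auto
    then have "tree_proj h (\<phi> t) = tree_proj h (\<phi> (Inf (tree_proj g t)))"
      using tree_proj_eq_iff[OF excursion_h varphi_unit varphi_unit] dist_varphi[OF t] by simp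
    then show ?thesis unfolding j_def using t by simp
  qed
  moreover have "j \<in> tree_points g \<rightarrow>\<^sub>E tree_points h"
    unfolding j_def using varphi_unit by auto
  ultimately have "?P j" by blast
  moreover have "j' = j" if j': "?P j'" for j'
  proof (rule PiE_ext)
    show "j' \<in> tree_points g \<rightarrow>\<^sub>E tree_points h" using j' by blast
    show "j \<in> tree_points g \<rightarrow>\<^sub>E tree_points h" using \<open>?P j\<close> by blast
    fix X assume "X \<in> tree_points g"
    then obtain t where "t \<in> {0..1}" "X = tree_proj g t" unfolding tree_points_eq by blast
    then show "j' X = j X" using j' \<open>?P j\<close> by simp
  qed
  ultimately have "\<exists>!j. ?P j" by (intro ex1I[of ?P j])
  from theI'[OF this] show ?thesis unfolding jmap_def .
qed

lemma jmap_proj: "t \<in> {0..1} \<Longrightarrow> \<j> (tree_proj g t) = tree_proj h (\<phi> t)"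
  using jmap_spec by blast

lemma jmap_in: "X \<in> tree_points g \<Longrightarrow> \<j> X \<in> tree_points h"
  using jmap_spec by blast

lemma jmap_class: "X \<in> tree_points g \<Longrightarrow> x \<in> X \<Longrightarrow> \<j> X = tree_proj h (\<phi> x)"
  using tree_point_eq_proj[OF excursion, of X x] jmap_proj[of x] by simp

lemma jmap_dist:
  assumes "X \<in> tree_points g" "Y \<in> tree_points g"
  shows "tree_dist h (\<j> X) (\<j> Y) = tree_dist g X Y"
proof -
  obtain x y where "x \<in> {0..1}" "X = tree_proj g x" "y \<in> {0..1}" "Y = tree_proj g y"
    using assms unfolding tree_points_eq by blast
  then show ?thesis
    by (simp only: jmap_proj tree_dist_proj[OF excursion_h varphi_unit varphi_unit]
        tree_dist_proj[OF excursion] dist_varphi)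
qed

lemma jmap_root: "\<j> (tree_proj g 0) = tree_proj h 0"
proof -
  have "h (\<phi> 0) = 0"
    using level_varphi[of 0] excursion unfolding continuous_excursion_def by simp
  then have "pseudo_dist h 0 (\<phi> 0) = 0" unfolding pseudo_dist_0[OF excursion_h] .
  then have "tree_proj h 0 = tree_proj h (\<phi> 0)"
    by (intro tree_proj_eq_iff[OF excursion_h _ varphi_unit, THEN iffD2]) auto
  then show ?thesis using jmap_proj[of 0] by simp
qed

text \<open>Since \<open>\<phi>\<close> carries Lebesgue measure to itself, an interval around
  \<open>y\<close>, whose trace on the unit interval has positive length, cannot be missed by all
  times.\<close>

lemma varphi_range_dense:
  assumes "y \<in> {0..1}" "0 < r"
  obtains t where "t \<in> {0..1}" "\<bar>\<phi> t - y\<bar> < r"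
proof -
  define W where "W = {y - r<..<y + r}"
  have "{t \<in> {0..1}. \<phi> t \<in> W} \<noteq> {}"
  proof
    assume "{t \<in> {0..1}. \<phi> t \<in> W} = {}"
    moreover have "W \<in> sets borel" unfolding W_def by simp
    ultimately have "emeasure (lebesgue_on {0..1}) ({0..1} \<inter> W) = 0"
      by (metis emeasure_varphi_vimage emeasure_empty)
    then have "{0..1} \<inter> W \<in> null_sets lebesgue"
      unfolding W_def by (subst (asm) emeasure_restrict_space) (auto simp: null_sets_def)
    then obtain t where "t \<in> {0..1} - ({0..1} \<inter> W)" "\<bar>t - y\<bar> < r"
      using null_complement_dense[OF assms] by blast
    then show False unfolding W_def by auto
  qed
  then obtain t where "t \<in> {0..1}" "\<phi> t \<in> W" by blast
  then show thesis using that[of t] unfolding W_def by auto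
qed

text \<open>The tree distance from \<open>\<phi> t\<close> to a fixed \<open>y\<close> is continuous
  in \<open>t\<close> whether or not \<open>\<phi>\<close> is, because \<open>\<phi>\<close>
  preserves pseudo-distances. Its minimum is attained, and the dense range of \<open>\<phi>\<close>
  forces it to be 0.\<close>

lemma jmap_surj:
  assumes Y: "Y \<in> tree_points h"
  shows "\<exists>X\<in>tree_points g. \<j> X = Y"
proof -
  obtain y where y: "y \<in> {0..1}" "Y = tree_proj h y" using Y unfolding tree_points_eq by blast
  let ?f = "\<lambda>t. pseudo_dist h (\<phi> t) y"
  have "continuous_on {0..1} ?f"
    unfolding continuous_on_iff dist_real_def
  proof (intro ballI allI impI)
    fix x r :: real assume x: "x \<in> {0..1}" and "0 < r"
    then obtain d where d: "0 < d" "\<And>t. \<bar>t - x\<bar> < d \<Longrightarrow> pseudo_dist g x t < r"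
      using pseudo_dist_small[OF excursion] by metis
    have "\<bar>?f t - ?f x\<bar> < r" if t: "t \<in> {0..1}" "\<bar>t - x\<bar> < d" for t
      using d(2)[OF t(2)] dist_varphi[OF x t(1)] pseudo_dist_commute[of h "\<phi> x" "\<phi> t"]
        pseudo_dist_triangle[OF excursion_h, of "\<phi> t" y "\<phi> x"]
        pseudo_dist_triangle[OF excursion_h, of "\<phi> x" y "\<phi> t"] by linarith
    then show "\<exists>d>0. \<forall>t\<in>{0..1}. \<bar>t - x\<bar> < d \<longrightarrow> \<bar>?f t - ?f x\<bar> < r" using d(1) by blast
  qed
  then obtain t where t: "t \<in> {0..1}" "\<And>u. u \<in> {0..1} \<Longrightarrow> ?f t \<le> ?f u"
    using continuous_attains_inf[of "{0..1}" ?f] by auto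
  have "?f t = 0"
  proof (rule ccontr)
    assume "?f t \<noteq> 0"
    then have "0 < ?f t" using pseudo_dist_nonneg[OF excursion_h, of "\<phi> t" y] by linarith
    then obtain d where d: "0 < d" "\<And>z. \<bar>z - y\<bar> < d \<Longrightarrow> pseudo_dist h y z < ?f t"
      using pseudo_dist_small[OF excursion_h] by metis
    obtain u where u: "u \<in> {0..1}" "\<bar>\<phi> u - y\<bar> < d" using varphi_range_dense[OF y(1) d(1)] .
    show False using d(2)[OF u(2)] t(2)[OF u(1)] pseudo_dist_commute[of h y "\<phi> u"] by linarith
  qed
  then have "tree_proj h (\<phi> t) = Y"
    unfolding y(2) by (intro tree_proj_eq_iff[OF excursion_h varphi_unit y(1), THEN iffD2])
  then show ?thesis using jmap_proj[OF t(1)] tree_proj_in[OF t(1)] by metis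
qed

lemma jmap_bij: "bij_betw \<j> (tree_points g) (tree_points h)"
  unfolding bij_betw_def
proof
  interpret G: Metric_space "tree_points g" "tree_dist g" by (rule tree_metric[OF excursion])
  interpret H: Metric_space "tree_points h" "tree_dist h" by (rule tree_metric[OF excursion_h])
  show "inj_on \<j> (tree_points g)"
  proof (rule inj_onI)
    fix X Y assume XY: "X \<in> tree_points g" "Y \<in> tree_points g" "\<j> X = \<j> Y"
    then have "tree_dist g X Y = 0"
      using jmap_dist[OF XY(1,2)] jmap_in[OF XY(2)] by simp
    then show "X = Y" using XY(1,2) by simp
  qed
  show "\<j> ` tree_points g = tree_points h"
    using jmap_in jmap_surj by blast
qed

lemma jmap_measurable: "\<j> \<in> tree_measure g \<rightarrow>\<^sub>M tree_measure h"
proof -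
  have "\<j> \<in> tree_borel g \<rightarrow>\<^sub>M tree_borel h"
    using jmap_in jmap_dist by (intro isometry_measurable excursion excursion_h) auto
  then show ?thesis by (simp cong: measurable_cong_sets)
qed

lemma jmap_distr: "distr (tree_measure g) (tree_measure h) \<j> = tree_measure h"
proof (rule measure_eqI)
  fix A assume "A \<in> sets (distr (tree_measure g) (tree_measure h) \<j>)"
  then have A: "A \<in> sets (tree_borel h)" by simp
  have jA: "\<j> -` A \<inter> tree_points g \<in> sets (tree_borel g)"
    using measurable_sets[OF jmap_measurable, of A] A by simp
  \<comment> \<open>\<open>U\<close> is shown to be Borel, and not just Lebesgue measurable, because
    \<open>emeasure_varphi_vimage\<close> is stated for Borel sets.\<close>
  define U where "U = {t \<in> {0..1}. tree_proj h t \<in> A}"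
  have "U = tree_proj h -` A \<inter> space (restrict_space borel {0..1})"
    unfolding U_def by (auto simp: space_restrict_space)
  then have "U \<in> sets (restrict_space borel {0..1})"
    using measurable_sets[OF tree_proj_measurable[OF excursion_h] A] by simp
  then have U: "U \<in> sets borel" "U \<subseteq> {0..1}" by (auto simp: sets_restrict_space_iff U_def)
  have "emeasure (distr (tree_measure g) (tree_measure h) \<j>) A
      = emeasure (tree_measure g) (\<j> -` A \<inter> tree_points g)"
    using A by (simp add: emeasure_distr[OF jmap_measurable])
  also have "\<dots> = emeasure (lebesgue_on {0..1}) {t \<in> {0..1}. tree_proj g t \<in> \<j> -` A \<inter> tree_points g}"
    by (rule emeasure_tree_measure[OF excursion jA])
  also have "{t \<in> {0..1}. tree_proj g t \<in> \<j> -` A \<inter> tree_points g} = {t \<in> {0..1}. \<phi> t \<in> U}"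
    using jmap_proj varphi_unit unfolding U_def by (intro Collect_cong conj_cong) simp_all
  also have "emeasure (lebesgue_on {0..1}) \<dots> = emeasure (lebesgue_on {0..1}) ({0..1} \<inter> U)"
    by (rule emeasure_varphi_vimage[OF U(1)])
  also have "{0..1} \<inter> U = {t \<in> {0..1}. tree_proj h t \<in> A}" unfolding U_def by auto
  also have "emeasure (lebesgue_on {0..1}) \<dots> = emeasure (tree_measure h) A"
    by (rule emeasure_tree_measure[OF excursion_h A, symmetric])
  finally show "emeasure (distr (tree_measure g) (tree_measure h) \<j>) A = emeasure (tree_measure h) A" .
qed simp

text \<open>This replaces continuity of \<open>\<phi>\<close> at \<open>x\<close>: off
  \<open>V\<close> the distance to the class of \<open>\<phi> x\<close> has a positive minimum by
  compactness, and nearby times are not sent that far. The whole class must lie in \<open>V\<close>,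
  since the pseudo-distance does not separate its members.\<close>

lemma varphi_near_class:
  assumes x: "x \<in> {0..1}" and V: "open V" "tree_proj h (\<phi> x) \<subseteq> V"
  obtains d where "0 < d" "\<And>z. z \<in> {0..1} \<Longrightarrow> \<bar>z - x\<bar> < d \<Longrightarrow> \<phi> z \<in> V"
proof (cases "{0..1} - V = {}")
  case True
  then have "\<phi> z \<in> V" for z using varphi_unit[of z] by blast
  then show thesis using that[of 1] by simp
next
  case False
  have "compact ({0..1} - V)" using V(1) by (intro compact_diff) auto
  moreover have "continuous_on ({0..1} - V) (\<lambda>u. pseudo_dist h u (\<phi> x))"
    using continuous_on_subset[OF pseudo_dist_continuous[OF excursion_h] subset_UNIV] .
  ultimately obtain u where u: "u \<in> {0..1} - V"
    "\<And>v. v \<in> {0..1} - V \<Longrightarrow> pseudo_dist h u (\<phi> x) \<le> pseudo_dist h v (\<phi> x)"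
    using continuous_attains_inf[OF _ False, of "\<lambda>u. pseudo_dist h u (\<phi> x)"] by blast
  have "u \<notin> tree_proj h (\<phi> x)" "u \<in> {0..1}" using u(1) V(2) by auto
  then have "pseudo_dist h (\<phi> x) u \<noteq> 0"
    using varphi_unit[of x] unfolding mem_tree_proj_iff by simp
  then have "0 < pseudo_dist h u (\<phi> x)"
    using pseudo_dist_nonneg[OF excursion_h, of u "\<phi> x"] pseudo_dist_commute[of h u "\<phi> x"] by linarith
  then obtain d where d: "0 < d" "\<And>z. \<bar>z - x\<bar> < d \<Longrightarrow> pseudo_dist g x z < pseudo_dist h u (\<phi> x)"
    using pseudo_dist_small[OF excursion] by metis
  have "\<phi> z \<in> V" if z: "z \<in> {0..1}" "\<bar>z - x\<bar> < d" for z
  proof (rule ccontr)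
    assume "\<phi> z \<notin> V"
    then have "pseudo_dist h u (\<phi> x) \<le> pseudo_dist h (\<phi> z) (\<phi> x)"
      using varphi_unit[of z] by (intro u(2)) simp
    then show False using d(2)[OF z(2)] dist_varphi[OF z(1) x] pseudo_dist_commute[of g x z] by linarith
  qed
  then show thesis using that d(1) by blast
qed

text \<open>Monotonicity of \<open>\<phi>\<close> is known on \<open>N\<close> only, so
  \<open>x\<close> and \<open>y\<close> are approximated from \<open>N\<close>. The approximation
  loses the position inside a class, which is why a first visit is compared with a last
  visit.\<close>

lemma Inf_le_Sup_of_signed_less:
  assumes X: "X \<in> tree_points g" "x \<in> X" and Y: "Y \<in> tree_points g" "y \<in> Y"
    and d: "0 < d" "\<And>z w. z \<in> N \<Longrightarrow> w \<in> N \<Longrightarrow> \<bar>z - x\<bar> < d \<Longrightarrow> \<bar>w - y\<bar> < d \<Longrightarrow> signed_less b g s z w"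
  shows "Inf (\<j> X) \<le> Sup (\<j> Y)"
proof (rule ccontr)
  assume n: "\<not> Inf (\<j> X) \<le> Sup (\<j> Y)"
  \<comment> \<open>If the bound failed, this midpoint would separate the two classes and therefore
    also the images of all nearby times.\<close>
  define c where "c = (Inf (\<j> X) + Sup (\<j> Y)) / 2"
  have c: "Sup (\<j> Y) < c" "c < Inf (\<j> X)" using n unfolding c_def by auto
  have x: "x \<in> {0..1}" and y: "y \<in> {0..1}"
    using tree_point_eq_proj(1)[OF excursion] X Y by blast+
  have "u \<in> {c<..}" if "u \<in> \<j> X" for u
    using tree_point_Inf_Sup(3)[OF excursion_h jmap_in[OF X(1)] that] c(2) by simp
  then have "tree_proj h (\<phi> x) \<subseteq> {c<..}" unfolding jmap_class[OF X, symmetric] by blast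
  then obtain d1 where d1: "0 < d1" "\<And>z. z \<in> {0..1} \<Longrightarrow> \<bar>z - x\<bar> < d1 \<Longrightarrow> \<phi> z \<in> {c<..}"
    using varphi_near_class[OF x open_greaterThan] by metis
  have "u \<in> {..<c}" if "u \<in> \<j> Y" for u
    using tree_point_Inf_Sup(4)[OF excursion_h jmap_in[OF Y(1)] that] c(1) by simp
  then have "tree_proj h (\<phi> y) \<subseteq> {..<c}" unfolding jmap_class[OF Y, symmetric] by blast
  then obtain d2 where d2: "0 < d2" "\<And>z. z \<in> {0..1} \<Longrightarrow> \<bar>z - y\<bar> < d2 \<Longrightarrow> \<phi> z \<in> {..<c}"
    using varphi_near_class[OF y open_lessThan] by metis
  obtain z where z: "z \<in> N" "\<bar>z - x\<bar> < min d d1" using N_dense[OF x, of "min d d1"] d d1 by auto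
  obtain w where w: "w \<in> N" "\<bar>w - y\<bar> < min d d2" using N_dense[OF y, of "min d d2"] d d2 by auto
  have "\<phi> z \<le> \<phi> w" using z w by (intro varphi_mono d(2)) auto
  moreover have "z \<in> {0..1}" "w \<in> {0..1}" using z w not_one_sided_minima_lebesgue(2)[OF crt] by auto
  ultimately show False using d1(2)[of z] d2(2)[of w] z w by auto
qed

text \<open>As neither point is an ancestor of the other, the path dips below both end values
  between them. The infimum in \<open>tree_swapped\<close> is attained only at the resulting
  minimum, so a single sign decides.\<close>

lemma separating_minimum:
  assumes X: "X \<in> tree_points g" and Y: "Y \<in> tree_points g"
    and na: "\<not> tree_ancestor g X Y" "\<not> tree_ancestor g Y X" and lt: "Sup X < Inf Y"
  obtains i where "unique_min_at b g i (Sup X) (Inf Y)"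
    "tree_swapped b g s X Y \<longleftrightarrow> s i = Minus"
proof -
  define x y where "x = Sup X" and "y = Inf Y"
  have xX: "x \<in> X" and yY: "y \<in> Y"
    unfolding x_def y_def using tree_point_Inf_Sup[OF excursion] X Y by blast+
  have x: "x \<in> {0..1}" and y: "y \<in> {0..1}"
    using tree_point_eq_proj(1)[OF excursion] X Y xX yY by blast+
  have xy: "x < y" using lt unfolding x_def y_def .
  then have I: "{min x y..max x y} = {x..y}" "{min y x..max y x} = {x..y}" by auto
  obtain w where w: "w \<in> {x..y}" "g w < g x"
    using na(1) x unfolding tree_ancestor_iff[OF excursion X Y xX yY] mem_ancestor_times_iff[OF excursion] I
    by (auto simp: not_le)
  obtain w' where w': "w' \<in> {x..y}" "g w' < g y"
    using na(2) y unfolding tree_ancestor_iff[OF excursion Y X yY xX] mem_ancestor_times_iff[OF excursion] I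
    by (auto simp: not_le)
  obtain i where i: "unique_min_at b g i x y"
    using unique_min_at_exists[where b = b, OF crt bij x y xy w w'] by blast
  then have bi: "b i g \<in> {x<..<y}" "\<And>z. z \<in> {x..y} \<Longrightarrow> z \<noteq> b i g \<Longrightarrow> g (b i g) < g z"
    unfolding unique_min_at_def by auto
  have le: "g (b i g) \<le> g z" if "z \<in> {x..y}" for z
    using bi(2)[OF that] by (cases "z = b i g") auto
  have inf: "(INF t\<in>{x..y}. g t) = g (b i g)"
    using bi(1) le by (intro cInf_eq_minimum) auto
  have "j = i" if j: "x < b j g" "b j g < y" "g (b j g) = (INF t\<in>{x..y}. g t)" for j
  proof -
    have "b j g = b i g" using bi(2)[of "b j g"] j inf by auto
    then show ?thesis using inj_b by (auto dest: injD)
  qed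
  then have "tree_swapped b g s X Y \<longleftrightarrow> s i = Minus"
    using inf bi(1) unfolding tree_swapped_def x_def[symmetric] y_def[symmetric] by force
  with i that show thesis unfolding x_def y_def by blast
qed

text \<open>Ancestral pairs are settled without signs, because the isometry preserves ancestry and
  an ancestor is visited first. For other pairs approximation yields a first visit bounded by a last
  visit, and disjointness of the time spans in the target sharpens this.\<close>

lemma jmap_mono:
  assumes X: "X \<in> tree_points g" and Y: "Y \<in> tree_points g" and le: "signed_tree_le b g s X Y"
  shows "tree_le h (\<j> X) (\<j> Y)"
proof -
  have anc: "tree_ancestor h (\<j> X) (\<j> Y) \<longleftrightarrow> tree_ancestor g X Y"
    if "X \<in> tree_points g" "Y \<in> tree_points g" for X Y
    unfolding tree_ancestor_def jmap_root[symmetric] using that by (simp add: jmap_dist)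
  note IX = tree_point_Inf_Sup[OF excursion X] and IY = tree_point_Inf_Sup[OF excursion Y]
  note JX = tree_point_Inf_Sup[OF excursion_h jmap_in[OF X]]
    and JY = tree_point_Inf_Sup[OF excursion_h jmap_in[OF Y]]
  consider (XY) "tree_ancestor g X Y" | (YX) "\<not> tree_ancestor g X Y" "tree_ancestor g Y X"
    | (none) "\<not> tree_ancestor g X Y" "\<not> tree_ancestor g Y X" by blast
  then show ?thesis
  proof cases
    case XY
    then have "tree_ancestor h (\<j> X) (\<j> Y)" using anc[OF X Y] by simp
    then show ?thesis unfolding tree_le_def
      by (rule tree_ancestor_Inf_Sup(1)[OF excursion_h jmap_in[OF X] jmap_in[OF Y] _ JY(1)])
  next
    case YX
    \<comment> \<open>This case contradicts \<open>le\<close>: the first visit to \<open>X\<close>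
      comes strictly after that of \<open>Y\<close> but not after \<open>Sup Y\<close>, so no
      minimum can swap the pair.\<close>
    have "tree_ancestor g X X" using between_class_ancestor[OF excursion X X IX(1)] IX by simp
    with YX(1) have "X \<noteq> Y" by auto
    moreover have "Inf Y \<le> Inf X" "Inf X \<le> Sup Y"
      using tree_ancestor_Inf_Sup[OF excursion Y X YX(2) IX(1)] by auto
    ultimately have "\<not> tree_le g X Y" "\<not> tree_swapped b g s Y X"
      using tree_le_antisym[OF excursion X Y] unfolding tree_le_def tree_swapped_def by auto
    then show ?thesis using le unfolding signed_tree_le_def by blast
  next
    case none
    have "Inf (\<j> X) \<le> Sup (\<j> Y)"
      using not_ancestor_cases[OF excursion X Y none]
    proof
      assume lt: "Sup X < Inf Y"
      obtain i where i: "unique_min_at b g i (Sup X) (Inf Y)" "tree_swapped b g s X Y \<longleftrightarrow> s i = Minus"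
        using separating_minimum[OF X Y none lt] .
      have "\<not> tree_le g Y X" using lt IX(3)[OF IX(2)] unfolding tree_le_def by linarith
      then have "s i \<noteq> Minus" using le i(2) unfolding signed_tree_le_def by blast
      then have si: "s i = Plus" by (cases "s i") auto
      obtain d where d: "0 < d" "\<And>z w. \<bar>z - Sup X\<bar> < d \<Longrightarrow> \<bar>w - Inf Y\<bar> < d \<Longrightarrow> unique_min_at b g i z w"
        using unique_min_at_nearby[OF i(1)] by metis
      have "signed_less b g s z w" if "unique_min_at b g i z w" for z w
        using that si unfolding signed_less_def by (auto simp: unique_min_at_def)
      then show ?thesis
        using d by (intro Inf_le_Sup_of_signed_less[OF X IX(2) Y IY(1) d(1)]) blast
    next
      assume lt: "Sup Y < Inf X"
      obtain i where i: "unique_min_at b g i (Sup Y) (Inf X)" "tree_swapped b g s Y X \<longleftrightarrow> s i = Minus"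
        using separating_minimum[OF Y X none(2,1) lt] .
      have "\<not> tree_le g X Y" using lt IY(3)[OF IY(2)] unfolding tree_le_def by linarith
      then have si: "s i = Minus" using le i(2) unfolding signed_tree_le_def by blast
      obtain d where d: "0 < d" "\<And>z w. \<bar>z - Sup Y\<bar> < d \<Longrightarrow> \<bar>w - Inf X\<bar> < d \<Longrightarrow> unique_min_at b g i z w"
        using unique_min_at_nearby[OF i(1)] by metis
      have "signed_less b g s w z" if "unique_min_at b g i z w" for z w
        using that si unfolding signed_less_def by (auto simp: unique_min_at_def)
      then show ?thesis
        using d by (intro Inf_le_Sup_of_signed_less[OF X IX(1) Y IY(2) d(1)]) blast
    qed
    moreover have "\<not> tree_ancestor h (\<j> X) (\<j> Y)" "\<not> tree_ancestor h (\<j> Y) (\<j> X)"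
      using none anc X Y by auto
    then have "Sup (\<j> X) < Inf (\<j> Y) \<or> Sup (\<j> Y) < Inf (\<j> X)"
      by (rule not_ancestor_cases[OF excursion_h jmap_in[OF X] jmap_in[OF Y]])
    ultimately show ?thesis using JX(3)[OF JX(2)] unfolding tree_le_def by linarith
  qed
qed

lemma jmap_isomorphism: "pom_isomorphism \<j> (signed_tree_space b g s) (tree_space h)"
  unfolding pom_isomorphism_def signed_tree_space_sel
  using jmap_bij jmap_dist jmap_root jmap_mono jmap_measurable jmap_distr by blast

text \<open>Since \<open>\<phi>\<close> preserves measure, for almost every \<open>t\<close> the
  value \<open>\<phi> t\<close> avoids the null set \<open>B\<close> outside which classes are
  singletons; then \<open>f t\<close> lies in the class \<open>{\<phi> t}\<close>.\<close>

lemma lift_eq_varphi: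
  assumes f: "f \<in> {0..1} \<rightarrow> {0..1}"
    and lift: "\<And>t. t \<in> {0..1} \<Longrightarrow> tree_proj h (f t) = \<j> (tree_proj g t)"
  shows "AE t in lebesgue_on {0..1}. f t = \<phi> t"
    and "f \<in> borel_measurable (lebesgue_on {0..1})"
    and "permuton b g s = distr (lebesgue_on {0..1}) borel (\<lambda>t. (t, f t))"
proof -
  let ?L = "lebesgue_on {0..1::real}"
  obtain B where B: "B \<in> null_sets lborel" "\<And>t. t \<in> {0..1} - B \<Longrightarrow> tree_proj h t = {t}"
    using singleton_classes[OF excursion_h crt_ancestor_times_null[OF crt_h]] by metis
  then have Bb: "B \<in> sets borel" "emeasure lborel B = 0" by (auto simp: null_sets_def)
  define E where "E = {t \<in> {0..1}. \<phi> t \<in> B}"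
  have "E = \<phi> -` B \<inter> space ?L" unfolding E_def by (auto simp: space_restrict_space)
  then have Es: "E \<in> sets ?L" using measurable_sets[OF varphi_measurable Bb(1)] by simp
  have "emeasure ?L E = emeasure ?L ({0..1} \<inter> B)"
    unfolding E_def by (rule emeasure_varphi_vimage[OF Bb(1)])
  also have "\<dots> = emeasure lebesgue ({0..1} \<inter> B)"
    using Bb(1) by (intro emeasure_restrict_space) auto
  also have "\<dots> \<le> emeasure lebesgue B" using Bb(1) by (intro emeasure_mono) auto
  also have "\<dots> = 0" using Bb by simp
  finally have E: "E \<in> null_sets ?L" using Es by (auto simp: null_sets_def)
  have eq: "f t = \<phi> t" if "t \<in> {0..1} - E" for t
  proof -
    have t: "t \<in> {0..1}" and "\<phi> t \<in> {0..1} - B" using that varphi_unit unfolding E_def by auto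
    then have "tree_proj h (f t) = {\<phi> t}" using lift[OF t] jmap_proj[OF t] B(2) by simp
    moreover have "f t \<in> tree_proj h (f t)" using f t by (auto simp: mem_tree_proj_iff)
    ultimately show ?thesis by simp
  qed
  show ae: "AE t in ?L. f t = \<phi> t"
    using AE_not_in[OF E] AE_space
    by eventually_elim (auto simp: space_restrict_space intro!: eq)
  show meas: "f \<in> borel_measurable ?L"
  proof (rule measurableI)
    fix A :: "real set" assume A: "A \<in> sets borel"
    \<comment> \<open>On \<open>E\<close> the lift is uncontrolled, but every subset of the null set
      \<open>E\<close> is Lebesgue measurable.\<close>
    have split: "f -` A \<inter> space ?L = ((\<phi> -` A \<inter> space ?L) - E) \<union> (f -` A \<inter> E)"
      using eq unfolding E_def by (auto simp: space_restrict_space)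
    have "E \<in> null_sets lebesgue"
      using E by (subst (asm) null_sets_restrict_space) auto
    then have "f -` A \<inter> E \<in> sets lebesgue"
      using null_sets_completion_subset[of "f -` A \<inter> E" E lborel] by blast
    moreover have "f -` A \<inter> E \<subseteq> {0..1}" unfolding E_def by auto
    ultimately have "f -` A \<inter> E \<in> sets ?L" by (simp add: sets_restrict_space_iff)
    moreover have "\<phi> -` A \<inter> space ?L \<in> sets ?L" by (rule measurable_sets[OF varphi_measurable A])
    ultimately show "f -` A \<inter> space ?L \<in> sets ?L" unfolding split using Es by blast
  qed simp
  have id: "(\<lambda>t. t) \<in> borel_measurable ?L"
    by (intro measurable_restrict_space1 measurable_completion) simp
  show "permuton b g s = distr ?L borel (\<lambda>t. (t, f t))"
    unfolding permuton_def
  proof (rule distr_cong_AE)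
    show "AE t in ?L. (t, \<phi> t) = (t, f t)" using ae by eventually_elim simp
  qed (use id meas varphi_measurable in \<open>auto intro: borel_measurable_Pair\<close>)
qed

end

theorem proposition1p10:
  fixes M :: "'w measure" and p :: real
    and b :: "nat \<Rightarrow> (real \<Rightarrow> real) \<Rightarrow> real"
    and e e' :: "'w \<Rightarrow> real \<Rightarrow> real" and S :: "'w \<Rightarrow> nat \<Rightarrow> sign"
  assumes "prob_space M"
    and "0 < p" and "p < 1"
    and "measurable_enumeration b"
    and "signed_brownian_excursion M p e S"
    and "AE \<omega> in M. e' \<omega> \<in> crt_excursions"
    and "brownian_excursion M e'"
    and "AE \<omega> in M. same_local_times (e \<omega>) (e' \<omega>)"
    and "AE \<omega> in M.
           (\<forall>x\<in>{0..1}. \<forall>y\<in>{0..1}.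
              pseudo_dist (e' \<omega>) (varphi b (e \<omega>) (S \<omega>) x) (varphi b (e \<omega>) (S \<omega>) y)
              = pseudo_dist (e \<omega>) x y) \<and>
           (\<forall>x\<in>{0..1}. e' \<omega> (varphi b (e \<omega>) (S \<omega>) x) = e \<omega> x)"
  shows "AE \<omega> in M.
     (pom_isomorphism (jmap b (e \<omega>) (S \<omega>) (e' \<omega>))
        (signed_tree_space b (e \<omega>) (S \<omega>)) (tree_space (e' \<omega>)) \<and>
      (\<forall>h k. continuous_excursion h \<longrightarrow>
         pom_isomorphism k (signed_tree_space b (e \<omega>) (S \<omega>)) (tree_space h) \<longrightarrow>
         h = e' \<omega> \<and> (\<forall>x\<in>tree_points (e \<omega>). k x = jmap b (e \<omega>) (S \<omega>) (e' \<omega>) x))) \<and>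
     (\<forall>f. f \<in> {0..1} \<rightarrow> {0..1} \<longrightarrow>
         (\<forall>t\<in>{0..1}. tree_proj (e' \<omega>) (f t)
            = jmap b (e \<omega>) (S \<omega>) (e' \<omega>) (tree_proj (e \<omega>) t)) \<longrightarrow>
         (AE t in lebesgue_on {0..1}. f t = varphi b (e \<omega>) (S \<omega>) t) \<and>
         f \<in> borel_measurable (lebesgue_on {0..1}) \<and>
         permuton b (e \<omega>) (S \<omega>) = distr (lebesgue_on {0..1}) borel (\<lambda>t. (t, f t)))"
proof -
  have "AE \<omega> in M. e \<omega> \<in> crt_excursions"
    using assms(5) unfolding signed_brownian_excursion_def by blast
  \<comment> \<open>The quantifiers over \<open>h\<close>, \<open>k\<close> and \<open>f\<close>
    stand inside the almost sure statement, so the deterministic results apply outcome by outcome on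
    one event of full probability.\<close>
  with assms(6,9) show ?thesis
  proof eventually_elim
    case (elim \<omega>)
    interpret signed_crt_pair b "e \<omega>" "S \<omega>" "e' \<omega>"
      by unfold_locales (use elim assms(4) in \<open>auto simp: measurable_enumeration_def\<close>)
    have "h = e' \<omega> \<and> (\<forall>x\<in>tree_points (e \<omega>). k x = jmap b (e \<omega>) (S \<omega>) (e' \<omega>) x)"
      if "continuous_excursion h" "pom_isomorphism k (signed_tree_space b (e \<omega>) (S \<omega>)) (tree_space h)" for h k
      using isomorphism_unique[OF that(1) excursion_h that(2) jmap_isomorphism] by blast
    moreover have "(AE t in lebesgue_on {0..1}. f t = varphi b (e \<omega>) (S \<omega>) t) \<and>
         f \<in> borel_measurable (lebesgue_on {0..1}) \<and>
         permuton b (e \<omega>) (S \<omega>) = distr (lebesgue_on {0..1}) borel (\<lambda>t. (t, f t))"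
      if "f \<in> {0..1} \<rightarrow> {0..1}"
        "\<forall>t\<in>{0..1}. tree_proj (e' \<omega>) (f t) = jmap b (e \<omega>) (S \<omega>) (e' \<omega>) (tree_proj (e \<omega>) t)" for f
      using lift_eq_varphi[of f] that by blast
    ultimately show ?case using jmap_isomorphism by blast
  qed
qed

end
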